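(* Let $C_i$ be a sequence of self-dual codes over $\mathbb{Z}_4$ with length $n(C_i)\to\infty$. Then \[ \limsup_{i\to\infty}\frac{d_H(C_i)}{n(C_i)}\le\frac{1-5^{-1/4}}{2},\qquad \limsup_{i\to\infty}\frac{d_L(C_i)}{n(C_i)}\le 1-5^{-1/4}, \] where $d_H(C)$ and $d_L(C)$ are the minimum Hamming and Lee weights of nonzero codewords of $C$.
   Context: A code over $\mathbb{Z}_4$ of length $n$ is a $\mathbb{Z}_4$-submodule of $\mathbb{Z}_4^n$; it is self-dual if it equals its dual with respect to the standard inner product $\sum x_iy_i \bmod 4$. The Lee weights of $0,1,2,3\in\mathbb{Z}_4$ are $0,1,2,1$, and the Lee weight of a vector is the sum of Lee weights of its coordinates. *)

theory Defs
  imports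
    Complex_Main
    "HOL-Library.Numeral_Type"
    "HOL-Library.Extended_Real"
    "HOL-Library.Liminf_Limsup"
    "Jordan_Normal_Form.VS_Connect"
begin

text \<open>
  The numeral type \<open>4\<close> is the library's ring of integers modulo 4, so the scalar product of
  vectors over it is already reduced modulo 4.
\<close>

type_synonym z4 = 4

definition z4_code :: "nat \<Rightarrow> z4 vec set \<Rightarrow> bool" where
  "z4_code n C \<longleftrightarrow> Module.submodule C class_ring (module_vec TYPE(z4) n)"

definition dual_code :: "nat \<Rightarrow> z4 vec set \<Rightarrow> z4 vec set" where
  "dual_code n C = {v \<in> carrier_vec n. \<forall>c\<in>C. v \<bullet> c = 0}"

definition self_dual_code :: "nat \<Rightarrow> z4 vec set \<Rightarrow> bool" where
  "self_dual_code n C \<longleftrightarrow> z4_code n C \<and> dual_code n C = C"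

definition hamming_weight :: "z4 vec \<Rightarrow> nat" where
  "hamming_weight v = card {i. i < dim_vec v \<and> v $ i \<noteq> 0}"

definition lee_weight_z4 :: "z4 \<Rightarrow> nat" where
  "lee_weight_z4 x = (if x = 0 then 0 else if x = 2 then 2 else 1)"

definition lee_weight :: "z4 vec \<Rightarrow> nat" where
  "lee_weight v = (\<Sum>i<dim_vec v. lee_weight_z4 (v $ i))"

text \<open>
  A self-dual code of positive length has a nonzero word, so only at length 0 are the sets below
  empty; there the infimum on the naturals carries no information. The length of a code with at
  least one word can be read off from its words, hence the zero vector of dimension
  \<open>dim_vec c\<close>.
\<close>

definition min_hamming_weight :: "z4 vec set \<Rightarrow> nat" where
  "min_hamming_weight C = Inf (hamming_weight ` {c \<in> C. c \<noteq> 0\<^sub>v (dim_vec c)})"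

definition min_lee_weight :: "z4 vec set \<Rightarrow> nat" where
  "min_lee_weight C = Inf (lee_weight ` {c \<in> C. c \<noteq> 0\<^sub>v (dim_vec c)})"

end

theory Submission
  imports Defs
    "HOL-Computational_Algebra.Formal_Power_Series"
    "HOL-Computational_Algebra.Polynomial_FPS"
    "HOL-Real_Asymp.Real_Asymp"
begin

text \<open>
  The supports of the odd coordinates of the words of a self-dual code \<open>C\<close> form a doubly-even binary
  code \<open>D\<close>, and for every \<open>u\<close> in the dual of \<open>D\<close> the vector equal to 2 on \<open>u\<close> lies in \<open>C\<close>; it has
  Hamming weight \<open>card u\<close> and Lee weight \<open>2 * card u\<close>. So it suffices to find a light word in the dual of
  a doubly-even binary code, whose length may be padded with zeros to \<open>8 * N\<close>.

  Summing the weight enumerator of \<open>D\<close> over the images under the octahedral group gives a polynomial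
  \<open>f\<close> in \<open>z = y ^ 4\<close> with nonnegative coefficients, supported on the weights of the dual of \<open>D\<close>, with the
  symmetries of the weight enumerator of a doubly-even self-dual code. As in Gleason's theorem,
  \<open>f\<close> is a combination of \<open>phi8 ^ (N - 3 * l) * psi24 ^ l\<close> with \<open>3 * l \<le> N\<close>. Hence, for
  \<open>t = psi24 / phi8 ^ 3\<close>, the coefficients of \<open>t ^ j\<close> and \<open>t ^ (j + 1)\<close> in \<open>f / phi8 ^ N\<close> vanish
  when \<open>3 * j > N\<close>. By Lagrange inversion these are linear functionals of the coefficients of \<open>f\<close>.
  Taking \<open>j\<close> near \<open>N / 3\<close> and subtracting \<open>R\<close> times the former from the latter, the weight given to
  the coefficient of \<open>z ^ k\<close> has, asymptotically, the sign of \<open>chi12 * (phi8 ^ 3 - R * psi24)\<close> at a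
  saddle point depending on \<open>k / j\<close>. For \<open>k = 0\<close> the saddle point is \<open>1 / 5\<close>; with \<open>R\<close> slightly above
  \<open>phi8 ^ 3 / psi24 = 3456 / 5\<close> at this point, the weights are positive at \<open>k = 0\<close>, at
  \<open>k = 1\<close> (where the padding may contribute words) and at all \<open>k\<close> exceeding
  \<open>(1 - 5 powr (- 1 / 4)) * N\<close> by a fixed proportion of \<open>N\<close>. Since the weighted sum of the coefficients vanishes and \<open>f 0 > 0\<close>, some
  coefficient with \<open>k\<close> between these is nonzero.
\<close>

section \<open>Polynomials with octahedral symmetry\<close>

text \<open>This encodes a form \<open>x ^ (8 * N) * f ((y / x) ^ 4)\<close> fixed by the
  MacWilliams substitution \<open>(x, y) \<mapsto> (x + y, x - y) / sqrt 2\<close>; the argument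
  \<open>y ^ 4\<close> builds in invariance under \<open>y \<mapsto> \<i> * y\<close>. The excluded
  points are the zeros of \<open>psi24 (y ^ 4)\<close>, so the property survives division by
  \<open>psi24\<close>.\<close>

definition oct_invariant :: "nat \<Rightarrow> real poly \<Rightarrow> bool" where
  "oct_invariant N f \<longleftrightarrow> degree f \<le> 2 * N \<and>
     (\<forall>y. y \<noteq> 0 \<and> y \<noteq> 1 \<and> y \<noteq> -1 \<longrightarrow>
        (1 + y) ^ (8 * N) * poly f (((1 - y) / (1 + y)) ^ 4) = 16 ^ N * poly f (y ^ 4))"

text \<open>The classical octahedral forms in \<open>z = y ^ 4\<close>: \<open>phi8\<close> is the
  weight enumerator of the extended Hamming code of length 8, \<open>psi24\<close> is the fourth
  power of \<open>x * y * (x ^ 4 - y ^ 4)\<close>, and \<open>chi12\<close> is the form of degree 12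
  attached to the edges. With \<open>t = psi24 / phi8 ^ 3\<close> one has
  \<open>z * t' / t = chi12 / ((1 - z) * phi8)\<close>.\<close>

definition phi8 :: "real poly" where "phi8 = [:1, 14, 1:]"
definition psi24 :: "real poly" where "psi24 = [:0, 1:] * [:1, -1:] ^ 4"
definition chi12 :: "real poly" where "chi12 = [:1, -33, -33, 1:]"

lemma poly_phi8: "poly phi8 z = 1 + 14 * z + z ^ 2"
  by (simp add: phi8_def power2_eq_square algebra_simps)

lemma poly_psi24: "poly psi24 z = z * (1 - z) ^ 4"
  by (simp add: psi24_def algebra_simps)

lemma poly_chi12: "poly chi12 z = 1 - 33 * z - 33 * z ^ 2 + z ^ 3"
  by (simp add: chi12_def power2_eq_square power3_eq_cube algebra_simps)

lemma phi8_transform: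
  fixes y :: real
  assumes "1 + y \<noteq> 0"
  shows "(1 + y) ^ 8 * poly phi8 (((1 - y) / (1 + y)) ^ 4) = 16 * poly phi8 (y ^ 4)"
proof -
  have "(1 + y) ^ 8 * poly phi8 (((1 - y) / (1 + y)) ^ 4)
      = (1 + y) ^ 8 + 14 * (1 - y) ^ 4 * (1 + y) ^ 4 + (1 - y) ^ 8"
    unfolding poly_phi8 using assms by (simp add: field_simps power_divide flip: power_mult)
  also have "\<dots> = 16 * poly phi8 (y ^ 4)"
    unfolding poly_phi8 by (simp add: eval_nat_numeral algebra_simps)
  finally show ?thesis .
qed

lemma psi24_transform:
  fixes y :: real
  assumes "1 + y \<noteq> 0"
  shows "(1 + y) ^ 24 * poly psi24 (((1 - y) / (1 + y)) ^ 4) = 16 ^ 3 * poly psi24 (y ^ 4)"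
proof -
  have "(1 + y) ^ 4 * (1 - ((1 - y) / (1 + y)) ^ 4) = (1 + y) ^ 4 - (1 - y) ^ 4"
    using assms by (simp add: right_diff_distrib power_divide)
  also have "\<dots> = 8 * y * (1 + y ^ 2)" by (simp add: eval_nat_numeral algebra_simps)
  finally have A: "(1 + y) ^ 4 * (1 - ((1 - y) / (1 + y)) ^ 4) = 8 * y * (1 + y ^ 2)" .
  have "(1 + y) ^ 24 = (1 + y) ^ 4 * (1 + y) ^ 4 * ((1 + y) ^ 4) ^ 4"
    by (simp flip: power_mult power_add)
  then have "(1 + y) ^ 24 * poly psi24 (((1 - y) / (1 + y)) ^ 4)
     = (1 + y) ^ 4 * ((1 + y) ^ 4 * ((1 - y) / (1 + y)) ^ 4) * ((1 + y) ^ 4 * (1 - ((1 - y) / (1 + y)) ^ 4)) ^ 4"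
    unfolding poly_psi24 by (simp add: power_mult_distrib)
  also have "\<dots> = (1 + y) ^ 4 * (1 - y) ^ 4 * (8 * y * (1 + y ^ 2)) ^ 4"
    unfolding A using assms by (simp add: power_divide)
  also have "\<dots> = 16 ^ 3 * poly psi24 (y ^ 4)"
  proof -
    have "1 - y ^ 4 = (1 + y) * (1 - y) * (1 + y ^ 2)" by (simp add: eval_nat_numeral algebra_simps)
    then show ?thesis unfolding poly_psi24 by (simp only:) (simp add: power_mult_distrib)
  qed
  finally show ?thesis .
qed

lemma oct_invariant_phi8_power: "oct_invariant N (phi8 ^ N)"
proof -
  have "degree phi8 = 2" by (simp add: phi8_def)
  then have "degree (phi8 ^ N) \<le> 2 * N" using degree_power_le[of phi8 N] by simp
  moreover have "(1 + y) ^ (8 * N) * poly (phi8 ^ N) (((1 - y) / (1 + y)) ^ 4) = 16 ^ N * poly (phi8 ^ N) (y ^ 4)"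
    if "y \<noteq> -1" for y
  proof -
    have "((1 + y) ^ 8 * poly phi8 (((1 - y) / (1 + y)) ^ 4)) ^ N = (16 * poly phi8 (y ^ 4)) ^ N"
      using phi8_transform[of y] that by (metis add_eq_0_iff)
    then show ?thesis by (simp only: power_mult_distrib power_mult poly_power)
  qed
  ultimately show ?thesis unfolding oct_invariant_def by blast
qed

lemma oct_invariant_diff_smult:
  assumes "oct_invariant N f" "oct_invariant N g"
  shows "oct_invariant N (f - smult c g)"
proof -
  have "degree (f - smult c g) \<le> 2 * N"
    using assms by (intro degree_diff_le order.trans[OF degree_smult_le]) (auto simp: oct_invariant_def)
  moreover have "(1 + y) ^ (8 * N) * poly (f - smult c g) (((1 - y) / (1 + y)) ^ 4) = 16 ^ N * poly (f - smult c g) (y ^ 4)"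
    if "y \<noteq> 0 \<and> y \<noteq> 1 \<and> y \<noteq> -1" for y
  proof -
    have "(1 + y) ^ (8 * N) * poly (f - smult c g) (((1 - y) / (1 + y)) ^ 4) =
      (1 + y) ^ (8 * N) * poly f (((1 - y) / (1 + y)) ^ 4) - c * ((1 + y) ^ (8 * N) * poly g (((1 - y) / (1 + y)) ^ 4))"
      by (simp add: algebra_simps)
    also have "\<dots> = 16 ^ N * poly f (y ^ 4) - c * (16 ^ N * poly g (y ^ 4))"
      using assms that unfolding oct_invariant_def by auto
    finally show ?thesis by (simp add: algebra_simps)
  qed
  ultimately show ?thesis unfolding oct_invariant_def by blast
qed

lemma poly_eqI_infinite:
  fixes p q :: "real poly"
  assumes "infinite A" "\<And>x. x \<in> A \<Longrightarrow> poly p x = poly q x"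
  shows "p = q"
proof (rule ccontr)
  assume "p \<noteq> q"
  then have "finite {x. poly (p - q) x = 0}" by (intro poly_roots_finite) simp
  moreover have "A \<subseteq> {x. poly (p - q) x = 0}" using assms(2) by auto
  ultimately show False using assms(1) finite_subset by blast
qed

text \<open>
  Applying the substitution at \<open>y\<close> and at \<open>-y\<close> composes to \<open>z \<mapsto> 1/z\<close>.
\<close>
lemma oct_invariant_palindromic:
  assumes "oct_invariant N f" "z > 0" "z \<noteq> 1"
  shows "poly f z = z ^ (2 * N) * poly f (1 / z)"
proof -
  define w where "w = root 4 z"
  have w: "w > 0" "w ^ 4 = z" using assms by (auto simp: w_def)
  have w1: "w \<noteq> 1" using w assms by auto
  define y where "y = (1 - w) / (1 + w)"
  have y: "1 + y = 2 / (1 + w)" "1 - y = 2 * w / (1 + w)"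
    using w by (auto simp: y_def field_simps)
  have "1 + y > 0" "1 - y > 0" using w unfolding y by simp_all
  then have ne: "1 + y \<noteq> 0" "1 - y \<noteq> 0" by simp_all
  have y0: "y \<noteq> 0" using w w1 by (simp add: y_def)
  have q: "(1 - y) / (1 + y) = w" "(1 + y) / (1 - y) = 1 / w"
  proof -
    have "1 - y = w * (1 + y)" by (simp add: y)
    then show "(1 - y) / (1 + y) = w" "(1 + y) / (1 - y) = 1 / w" using ne by simp_all
  qed
  have inv: "(1 + x) ^ (8 * N) * poly f (((1 - x) / (1 + x)) ^ 4) = 16 ^ N * poly f (x ^ 4)"
    if "x \<noteq> 0" "x \<noteq> 1" "x \<noteq> -1" for x
    using assms(1) that unfolding oct_invariant_def by blast
  have "(1 + y) ^ (8 * N) * poly f z = 16 ^ N * poly f (y ^ 4)"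
    using inv[of y] y0 ne q w by auto
  also have "\<dots> = (1 - y) ^ (8 * N) * poly f (1 / z)"
    using inv[of "-y"] y0 ne q w by (auto simp: power_divide)
  also have "1 - y = (1 + y) * w" by (simp add: y)
  also have "((1 + y) * w) ^ (8 * N) = (1 + y) ^ (8 * N) * z ^ (2 * N)"
    by (simp add: power_mult_distrib flip: w(2) power_mult)
  finally show ?thesis using ne by simp
qed

text \<open>By the palindromic symmetry, a zero at \<open>z = 0\<close> forces a zero at
  infinity.\<close>

lemma oct_invariant_degree_less:
  assumes "oct_invariant N f" "coeff f 0 = 0" "f \<noteq> 0"
  shows "degree f < 2 * N"
proof (rule ccontr)
  assume "\<not> ?thesis"
  with assms have deg: "degree f = 2 * N" unfolding oct_invariant_def by auto
  have "f = reflect_poly f"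
  proof (rule poly_eqI_infinite)
    show "infinite {1<..<2::real}" by (rule infinite_Ioo) simp
    fix z :: real assume "z \<in> {1<..<2}"
    then show "poly f z = poly (reflect_poly f) z"
      using oct_invariant_palindromic[OF assms(1), of z] by (simp add: poly_reflect_poly_nz deg inverse_eq_divide)
  qed
  then have "coeff f 0 = lead_coeff f" by (metis coeff_0_reflect_poly)
  with assms show False by simp
qed

lemma continuous_eq_at_limit:
  fixes F G :: "real \<Rightarrow> real"
  assumes "isCont F a" "isCont G a" "eventually (\<lambda>x. F x = G x) (at a)"
  shows "F a = G a"
proof -
  have "(F \<longlongrightarrow> G a) (at a)"
    using assms(2,3) unfolding isCont_def by (simp cong: tendsto_cong)
  then show ?thesis using assms(1) unfolding isCont_def by (rule LIM_unique[rotated])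
qed

text \<open>
  The substitution carries the zero of \<open>f (y ^ 4)\<close> at \<open>y = 0\<close>, whose order is at least 4, to
  \<open>y = 1\<close>.
\<close>
lemma oct_invariant_order_one:
  assumes f: "oct_invariant N f" "coeff f 0 = 0" "f \<noteq> 0"
  shows "[:1, -1:] ^ 4 dvd f"
proof -
  define r where "r = order 1 f"
  obtain h where h: "f = [:-1, 1:] ^ r * h" "\<not> [:-1, 1:] dvd h"
    using order_decomp[OF f(3), of 1] unfolding r_def by auto
  obtain g where g: "f = [:0, 1:] * g"
    using f(2) by (metis mult.commute dvd_def pCons_0_0 poly_0_coeff_0 poly_eq_0_iff_dvd minus_zero)
  have "r \<ge> 4"
  proof (rule ccontr)
    assume "\<not> r \<ge> 4"
    then have r: "r < 4" by simp
    \<comment> \<open>\<open>F\<close> and \<open>G\<close> are the two sides of the transformation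
      law with \<open>(y - 1) ^ r\<close> cancelled. A factor \<open>(y - 1) ^ (4 - r)\<close>
      remains in \<open>G\<close>, so in the limit at 1 the cofactor \<open>h\<close> would vanish,
      against the choice of \<open>r\<close>.\<close>
    define F where "F y = 16 ^ N * (1 + y + y^2 + y^3) ^ r * poly h (y ^ 4)" for y :: real
    define G where "G y = (y - 1) ^ (4 - r) * ((1 + y) ^ (8 * N) * (1 / (1 + y)) ^ 4 * poly g (((1 - y) / (1 + y)) ^ 4))"
      for y :: real
    have "eventually (\<lambda>y::real. y \<in> {0<..<2} - {1}) (at 1)"
      by (rule eventually_at_in_open) auto
    then have "eventually (\<lambda>y. F y = G y) (at 1)"
    proof eventually_elim
      case (elim y)
      have "(y - 1) ^ r * F y = 16 ^ N * ((y - 1) * (1 + y + y^2 + y^3)) ^ r * poly h (y ^ 4)"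
        by (simp add: F_def power_mult_distrib)
      also have "(y - 1) * (1 + y + y^2 + y^3) = y ^ 4 - 1" by (simp add: eval_nat_numeral algebra_simps)
      also have "16 ^ N * (y ^ 4 - 1) ^ r * poly h (y ^ 4) = 16 ^ N * poly f (y ^ 4)"
        by (simp add: h(1) poly_power)
      also have "\<dots> = (1 + y) ^ (8 * N) * poly f (((1 - y) / (1 + y)) ^ 4)"
        using f(1) elim unfolding oct_invariant_def by auto
      also have "\<dots> = (1 - y) ^ 4 * ((1 + y) ^ (8 * N) * (1 / (1 + y)) ^ 4 * poly g (((1 - y) / (1 + y)) ^ 4))"
        by (simp add: g power_divide)
      also have "(1 - y) ^ 4 = (y - 1) ^ 4" by (simp add: eval_nat_numeral algebra_simps)
      also have "\<dots> = (y - 1) ^ r * (y - 1) ^ (4 - r)" using r by (simp flip: power_add)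
      finally have "(y - 1) ^ r * F y = (y - 1) ^ r * G y" unfolding G_def by (simp only: mult.assoc)
      then show ?case using elim by simp
    qed
    moreover have "isCont F 1" unfolding F_def by (intro continuous_intros)
    moreover have "isCont G 1" unfolding G_def by (intro continuous_intros) auto
    ultimately have "F 1 = G 1" by (intro continuous_eq_at_limit)
    then have "poly h 1 = 0" using r by (simp add: F_def G_def zero_power)
    then show False using h(2) by (simp add: poly_eq_0_iff_dvd)
  qed
  then have "[:-1, 1:] ^ 4 dvd f" using h(1) by (simp add: le_imp_power_dvd dvd_mult2)
  moreover have "[:1, -1:] ^ 4 = [:-1, 1::real:] ^ 4" by (simp add: eval_nat_numeral)
  ultimately show ?thesis by simp
qed

text \<open>The reduction step of Gleason's theorem: the zero at 0 is carried to zeros at 1 and at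
  infinity, which are all those of \<open>psi24\<close>. The strict degree bound is what gives
  \<open>degree g \<le> 2 * (N - 3)\<close>.\<close>

lemma oct_invariant_divide:
  assumes f: "oct_invariant N f" "coeff f 0 = 0" "f \<noteq> 0"
  obtains g where "f = psi24 * g" "3 \<le> N" "oct_invariant (N - 3) g"
proof -
  obtain h where h: "f = [:1, -1:] ^ 4 * h" using oct_invariant_order_one[OF f] by blast
  have "coeff h 0 = 0" using f(2) unfolding h by (simp add: coeff_mult eval_nat_numeral)
  then obtain g where g: "h = [:0, 1:] * g"
    by (metis mult.commute dvd_def pCons_0_0 poly_0_coeff_0 poly_eq_0_iff_dvd minus_zero)
  have fg: "f = psi24 * g" unfolding h g psi24_def by (simp only: ac_simps)
  have "degree psi24 = 5" unfolding psi24_def by (simp add: degree_mult_eq degree_power_eq)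
  moreover have "g \<noteq> 0" "psi24 \<noteq> 0" using f(3) fg by auto
  ultimately have "degree f = 5 + degree g" unfolding fg by (simp add: degree_mult_eq)
  then have deg: "5 + degree g < 2 * N" using oct_invariant_degree_less[OF f] by simp
  then have N: "3 \<le> N" by simp
  have "oct_invariant (N - 3) g"
    unfolding oct_invariant_def
  proof (intro conjI allI impI)
    show "degree g \<le> 2 * (N - 3)" using deg N by linarith
    fix y :: real assume y: "y \<noteq> 0 \<and> y \<noteq> 1 \<and> y \<noteq> -1"
    define w where "w = ((1 - y) / (1 + y)) ^ 4"
    have ne: "1 + y \<noteq> 0" using y by auto
    have "16 ^ 3 * poly psi24 (y ^ 4) * ((1 + y) ^ (8 * (N - 3)) * poly g w)
        = (1 + y) ^ 24 * (1 + y) ^ (8 * (N - 3)) * (poly psi24 w * poly g w)"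
      using psi24_transform[OF ne] unfolding w_def by simp
    also have "\<dots> = (1 + y) ^ (8 * N) * poly f w"
      using N by (simp add: fg algebra_simps flip: power_add)
    also have "\<dots> = 16 ^ N * poly f (y ^ 4)" using f(1) y unfolding oct_invariant_def w_def by blast
    also have "\<dots> = 16 ^ (3 + (N - 3)) * poly f (y ^ 4)" using N by simp
    also have "\<dots> = 16 ^ 3 * poly psi24 (y ^ 4) * (16 ^ (N - 3) * poly g (y ^ 4))"
      unfolding power_add by (simp add: fg)
    finally have "16 ^ 3 * poly psi24 (y ^ 4) * ((1 + y) ^ (8 * (N - 3)) * poly g w)
        = 16 ^ 3 * poly psi24 (y ^ 4) * (16 ^ (N - 3) * poly g (y ^ 4))" .
    moreover have "16 ^ 3 * poly psi24 (y ^ 4) \<noteq> 0"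
    proof -
      have "y ^ 4 \<noteq> 1"
      proof
        assume "y ^ 4 = 1"
        then have "\<bar>y\<bar> ^ 4 = 1" by simp
        then have "\<bar>y\<bar> = 1" using power_eq_imp_eq_base[of "\<bar>y\<bar>" 4 1] by simp
        then show False using y by auto
      qed
      then show ?thesis using y by (simp add: poly_psi24)
    qed
    ultimately show "(1 + y) ^ (8 * (N - 3)) * poly g (((1 - y) / (1 + y)) ^ 4) = 16 ^ (N - 3) * poly g (y ^ 4)"
      unfolding w_def by simp
  qed
  then show ?thesis using that fg N by blast
qed

section \<open>Vanishing coefficients by Lagrange inversion\<close>

definition geom_pow :: "nat \<Rightarrow> real fps" where "geom_pow m = inverse ((1 - fps_X) ^ m)"

lemma geom_pow_inverse: "geom_pow m * (1 - fps_X) ^ m = 1"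
  unfolding geom_pow_def by (rule inverse_mult_eq_1) (simp add: fps_power_zeroth)

lemma geom_pow_mult: "geom_pow (a + m) * (1 - fps_X) ^ a = geom_pow m"
proof -
  have "geom_pow (a + m) = geom_pow a * geom_pow m"
    unfolding geom_pow_def power_add by (rule fps_inverse_mult)
  then show ?thesis using geom_pow_inverse[of a] by (simp add: mult_ac)
qed

lemma geom_pow_deriv: "(1 - fps_X) * fps_deriv (geom_pow m) = of_nat m * geom_pow m"
proof -
  have "fps_deriv (geom_pow m * (1 - fps_X) ^ m) = 0"
    by (simp add: geom_pow_inverse)
  then have "fps_deriv (geom_pow m) * (1 - fps_X) ^ m = geom_pow m * of_nat m * (1 - fps_X) ^ (m - 1)"
    by (simp add: fps_deriv_power' mult_ac)
  then have "((1 - fps_X) * fps_deriv (geom_pow m)) * (1 - fps_X) ^ m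
     = geom_pow m * of_nat m * ((1 - fps_X) * (1 - fps_X) ^ (m - 1))"
    by (simp add: mult_ac)
  also have "\<dots> = of_nat m * geom_pow m * (1 - fps_X) ^ m"
    by (cases m) (simp_all add: mult_ac)
  finally show ?thesis
  proof -
    assume *: "((1 - fps_X) * fps_deriv (geom_pow m)) * (1 - fps_X) ^ m = of_nat m * geom_pow m * (1 - fps_X) ^ m"
    have "(1 - fps_X :: real fps) ^ m \<noteq> 0"
      by (metis geom_pow_inverse mult_zero_right zero_neq_one)
    with * show ?thesis by simp
  qed
qed

text \<open>
  With \<open>u = (phi8 ^ 3 / (1 - z) ^ 4) ^ i\<close> the series below is \<open>u - z u' / i\<close>, which has no term in
  \<open>z ^ i\<close>.
\<close>
lemma residue_vanishes:
  assumes "i > 0"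
  shows "fps_nth (fps_of_poly (phi8 ^ (3 * i - 1) * chi12) * geom_pow (4 * i + 1)) i = 0"
proof -
  define P where "P = fps_of_poly phi8"
  define u where "u = P ^ (3 * i) * geom_pow (4 * i)"
  have P: "P = 1 + 14 * fps_X + fps_X ^ 2"
    by (simp add: P_def phi8_def fps_of_poly_pCons power2_eq_square algebra_simps)
  have chi: "fps_of_poly chi12 = 1 - 33 * fps_X - 33 * fps_X ^ 2 + fps_X ^ 3"
    by (simp add: chi12_def fps_of_poly_pCons power2_eq_square power3_eq_cube algebra_simps)
  have dP: "fps_deriv P = 14 + 2 * fps_X"
    by (simp add: P power2_eq_square algebra_simps)
  define G where "G = geom_pow (4 * i + 1)"
  have G0: "geom_pow (4 * i) = (1 - fps_X) * G"
    using geom_pow_mult[of 1 "4 * i"] by (simp add: G_def mult_ac)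
  have dG: "fps_deriv (geom_pow (4 * i)) = of_nat (4 * i) * G"
  proof -
    have "(1 - fps_X) * fps_deriv (geom_pow (4 * i)) = (1 - fps_X) * (of_nat (4 * i) * G)"
      using geom_pow_deriv[of "4 * i"] by (metis G0 mult.left_commute)
    moreover have "(1 - fps_X :: real fps) \<noteq> 0" 
      by (metis geom_pow_inverse[of 1] mult_zero_right power_one_right zero_neq_one)
    ultimately show ?thesis by simp
  qed
  obtain k where k: "3 * i = Suc k" using assms by (cases "3 * i") auto
  have "fps_X * fps_deriv u = fps_X * (of_nat (3 * i) * fps_deriv P * P ^ k * ((1 - fps_X) * G)
       + P ^ Suc k * (of_nat (4 * i) * G))"
    unfolding u_def fps_deriv_mult dG fps_deriv_power' k unfolding G0 by (simp add: algebra_simps)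
  also have "\<dots> = of_nat i * (P ^ k * G * (3 * fps_X * fps_deriv P * (1 - fps_X) + 4 * fps_X * P))"
    by (simp add: algebra_simps)
  finally have "of_nat i * u - fps_X * fps_deriv u
      = of_nat i * (P ^ k * G * (P * (1 - fps_X) - 3 * fps_X * fps_deriv P * (1 - fps_X) - 4 * fps_X * P))"
    unfolding u_def k G0 by (simp add: algebra_simps)
  also have "P * (1 - fps_X) - 3 * fps_X * fps_deriv P * (1 - fps_X) - 4 * fps_X * P = fps_of_poly chi12"
    unfolding dP unfolding P chi by (simp add: algebra_simps power2_eq_square power3_eq_cube)
  also have "P ^ k * G * fps_of_poly chi12 = fps_of_poly (phi8 ^ (3 * i - 1) * chi12) * geom_pow (4 * i + 1)"
    unfolding k P_def G_def by (simp add: fps_of_poly_mult fps_of_poly_power mult_ac)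
  finally have eq: "of_nat i * u - fps_X * fps_deriv u =
      of_nat i * (fps_of_poly (phi8 ^ (3 * i - 1) * chi12) * geom_pow (4 * i + 1))" .
  have "fps_nth (of_nat i * u - fps_X * fps_deriv u) i = 0"
    using assms by (simp flip: fps_of_nat)
  then have "of_nat i * fps_nth (fps_of_poly (phi8 ^ (3 * i - 1) * chi12) * geom_pow (4 * i + 1)) i = 0"
    unfolding eq by (simp flip: fps_of_nat)
  with assms show ?thesis by simp
qed

text \<open>Lagrange inversion identifies this coefficient with that of \<open>t ^ j\<close> in
  \<open>f / phi8 ^ N\<close>, where \<open>t = psi24 / phi8 ^ 3\<close>. The multiple of
  \<open>phi8 ^ N\<close> contributes nothing by \<open>residue_vanishes\<close>, and the rest is
  divisible by \<open>psi24\<close>; passing from \<open>(N, j)\<close> to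
  \<open>(N - 3, j - 1)\<close> leaves the exponent \<open>3 * j - N - 1\<close> unchanged.\<close>

lemma oct_invariant_coeff_vanishes:
  assumes "oct_invariant N f" "N < 3 * j"
  shows "fps_nth (fps_of_poly (f * phi8 ^ (3 * j - N - 1) * chi12) * geom_pow (4 * j + 1)) j = 0"
  using assms
proof (induction N arbitrary: f j rule: less_induct)
  case (less N)
  define c where "c = coeff f 0"
  define f' where "f' = f - smult c (phi8 ^ N)"
  define T where "T p = fps_nth (fps_of_poly (p * phi8 ^ (3 * j - N - 1) * chi12) * geom_pow (4 * j + 1)) j" for p
  have f': "oct_invariant N f'"
    unfolding f'_def by (intro oct_invariant_diff_smult less.prems oct_invariant_phi8_power)
  have "coeff (phi8 ^ N) 0 = 1" by (simp add: phi8_def coeff_0_power)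
  then have f'0: "coeff f' 0 = 0" by (simp add: f'_def c_def)
  have j: "j > 0" using less.prems by simp
  have "T (phi8 ^ N) = 0"
  proof -
    have "phi8 ^ N * phi8 ^ (3 * j - N - 1) = phi8 ^ (3 * j - 1)"
      using less.prems by (simp flip: power_add)
    then show ?thesis unfolding T_def using residue_vanishes[OF j] by simp
  qed
  moreover have "T f' = 0"
  proof (cases "f' = 0")
    case True
    then show ?thesis by (simp add: T_def)
  next
    case False
    obtain g where g: "f' = psi24 * g" "3 \<le> N" "oct_invariant (N - 3) g"
      using oct_invariant_divide[OF f' f'0 False] by blast
    have IH: "fps_nth (fps_of_poly (g * phi8 ^ (3 * (j - 1) - (N - 3) - 1) * chi12) * geom_pow (4 * (j - 1) + 1)) (j - 1) = 0"
      using less.prems g by (intro less.IH) auto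
    define A where "A = fps_of_poly (g * phi8 ^ (3 * j - N - 1) * chi12)"
    have e: "3 * (j - 1) - (N - 3) - 1 = 3 * j - N - 1" using g(2) by simp
    have psi: "fps_of_poly psi24 = fps_X * (1 - fps_X) ^ 4"
      unfolding psi24_def by (simp add: fps_of_poly_mult fps_of_poly_power fps_of_poly_pCons)
    have "fps_of_poly (f' * phi8 ^ (3 * j - N - 1) * chi12) * geom_pow (4 * j + 1)
        = fps_X * (A * (geom_pow (4 + (4 * (j - 1) + 1)) * (1 - fps_X) ^ 4))"
      using j unfolding g A_def by (cases j) (simp_all add: fps_of_poly_mult psi mult_ac)
    also have "\<dots> = fps_X * (A * geom_pow (4 * (j - 1) + 1))"
      unfolding geom_pow_mult ..
    finally show ?thesis using IH j unfolding T_def A_def e by simp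
  qed
  moreover have "T f = T f' + c * T (phi8 ^ N)"
  proof -
    have "f = f' + smult c (phi8 ^ N)" by (simp add: f'_def)
    then show ?thesis unfolding T_def
      by (simp add: distrib_right fps_of_poly_add fps_of_poly_mult fps_of_poly_smult mult.assoc)
  qed
  ultimately show ?case by (simp add: T_def)
qed

section \<open>Saddle point estimates\<close>

lemma geom_pow_nth: "fps_nth (geom_pow (Suc M)) r = real ((M + r) choose r)"
  unfolding geom_pow_def
  using one_minus_const_fps_X_neg_power'[of "Suc M" "1::real"] by simp

text \<open>A quotient of binomial coefficients as a product, close to
  \<open>(r / (M + r)) ^ i\<close>. The factor at \<open>l = r\<close> makes it vanish for
  \<open>i > r\<close>.\<close>

definition fall_ratio :: "nat \<Rightarrow> nat \<Rightarrow> nat \<Rightarrow> real" where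
  "fall_ratio M r i = (\<Prod>l<i. (real r - real l) / (real (M + r) - real l))"

lemma fall_ratio_binomial:
  assumes "i \<le> M"
  shows "real ((M + r) choose r) * fall_ratio M r i =
           (if i \<le> r then real ((M + r - i) choose (r - i)) else 0)"
  using assms
proof (induction i)
  case 0
  then show ?case by (simp add: fall_ratio_def)
next
  case (Suc i)
  have IH: "real ((M + r) choose r) * fall_ratio M r i =
      (if i \<le> r then real ((M + r - i) choose (r - i)) else 0)"
    using Suc by simp
  have "real ((M + r) choose r) * fall_ratio M r (Suc i)
      = (real ((M + r) choose r) * fall_ratio M r i) * ((real r - real i) / (real (M + r) - real i))"
    by (simp add: fall_ratio_def)
  also have "\<dots> = (if Suc i \<le> r then real ((M + r - Suc i) choose (r - Suc i)) else 0)"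
  proof (cases "Suc i \<le> r")
    case True
    define s where "s = r - Suc i"
    have r: "r = s + Suc i" using True by (simp add: s_def)
    have "Suc s * ((M + Suc s) choose Suc s) = (M + Suc s) * ((M + s) choose s)"
      using Suc_times_binomial_eq[of "M + s" s] by (simp add: mult.commute)
    then have "real (Suc s) * real ((M + Suc s) choose Suc s) = real (M + Suc s) * real ((M + s) choose s)"
      by (metis of_nat_mult)
    then have "real ((M + Suc s) choose Suc s) * (real (Suc s) / real (M + Suc s)) = real ((M + s) choose s)"
      by (simp add: field_simps)
    moreover have "i \<le> r" "M + r - i = M + Suc s" "r - i = Suc s" "M + r - Suc i = M + s" "r - Suc i = s"
      "real r - real i = real (Suc s)" "real (M + r) - real i = real (M + Suc s)"
      by (simp_all add: r)
    ultimately show ?thesis using True unfolding IH by (simp only: if_True)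
  next
    case False
    then show ?thesis unfolding IH by (cases "i = r") auto
  qed
  finally show ?case .
qed

text \<open>Each factor is within \<open>d / (M - d)\<close> of the saddle point, and both have
  absolute value at most 1 because \<open>2 * d \<le> M\<close>. Exchanging the factors one at a
  time therefore adds the errors, uniformly in \<open>r\<close>.\<close>

lemma fall_ratio_approx:
  assumes "2 * d \<le> M" "i \<le> d"
  shows "\<bar>fall_ratio M r i - (real r / real (M + r)) ^ i\<bar> \<le> real (i * d) / (real M - real d)"
  using assms(2)
proof (induction i)
  case 0
  then show ?case by (simp add: fall_ratio_def)
next
  case (Suc i)
  define x where "x = real r / real (M + r)"
  define a where "a = (real r - real i) / (real (M + r) - real i)"
  have M: "real d \<le> real M - real d" "real i + 1 \<le> real d" using assms(1) Suc.prems by linarith+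
  have pos: "real (M + r) - real i > 0" "real (M + r) > 0" "real M - real d > 0" using M by simp_all
  have x: "\<bar>x\<bar> \<le> 1" using pos by (simp add: x_def field_simps)
  have a: "\<bar>a\<bar> \<le> 1"
  proof -
    have "\<bar>real r - real i\<bar> \<le> real (M + r) - real i" using M by linarith
    then show ?thesis unfolding a_def using pos by (simp add: field_simps)
  qed
  define p q where "p = real i / (real (M + r) - real i)" and "q = real M / real (M + r)"
  have "x - a = p * q"
    using pos unfolding x_def a_def p_def q_def by (simp add: field_simps)
  moreover have "q \<le> 1" "0 \<le> q" "0 \<le> p" using pos by (simp_all add: p_def q_def)
  ultimately have "\<bar>x - a\<bar> \<le> real i / (real (M + r) - real i)"
    unfolding p_def[symmetric] by (simp add: mult_left_le)
  also have "\<dots> \<le> real d / (real M - real d)"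
    using M pos by (intro frac_le) auto
  finally have xa: "\<bar>a - x\<bar> \<le> real d / (real M - real d)" by simp
  have IH: "\<bar>fall_ratio M r i - x ^ i\<bar> \<le> real (i * d) / (real M - real d)"
    using Suc unfolding x_def by simp
  have "fall_ratio M r (Suc i) - x ^ Suc i = (fall_ratio M r i - x ^ i) * a + x ^ i * (a - x)"
    by (simp add: fall_ratio_def a_def algebra_simps)
  also have "\<bar>\<dots>\<bar> \<le> \<bar>fall_ratio M r i - x ^ i\<bar> * \<bar>a\<bar> + \<bar>x ^ i\<bar> * \<bar>a - x\<bar>"
    by (metis abs_mult abs_triangle_ineq)
  also have "\<dots> \<le> \<bar>fall_ratio M r i - x ^ i\<bar> * 1 + 1 * \<bar>a - x\<bar>"
    using a x by (intro add_mono mult_left_mono mult_right_mono) (auto simp: power_abs power_le_one)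
  also have "\<dots> \<le> real (i * d) / (real M - real d) + real d / (real M - real d)"
    using IH xa by simp
  also have "\<dots> = real (Suc i * d) / (real M - real d)"
    by (simp add: add_divide_distrib)
  finally show ?case unfolding x_def .
qed

text \<open>
  The coefficient of \<open>z ^ r\<close> in \<open>Q (z) (1 - z) ^ (- M - 1)\<close> is, up to a relative error tending to
  0 uniformly in \<open>r\<close>, the binomial coefficient times the value of \<open>Q\<close> at the saddle point
  \<open>r / (M + r)\<close>.
\<close>
lemma coeff_pos_of_saddle:
  fixes Q :: "real poly" and \<eta> :: real
  assumes "\<eta> > 0"
  shows "\<exists>M0. \<forall>M\<ge>M0. \<forall>r. \<eta> \<le> poly Q (real r / real (M + r)) \<longrightarrow>
           0 < fps_nth (fps_of_poly Q * geom_pow (Suc M)) r"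
proof -
  define d where "d = degree Q"
  define K where "K = (\<Sum>i\<le>d. \<bar>coeff Q i\<bar>)"
  \<comment> \<open>Once \<open>M - d \<ge> M1\<close>, the total error
    \<open>K * d ^ 2 / (M - d)\<close> is below \<open>\<eta>\<close>.\<close>
  obtain M1 :: nat where M1: "real M1 > K * (real d * real d) / \<eta>" using reals_Archimedean2 by blast
  show ?thesis
  proof (intro exI allI impI)
    fix M r :: nat
    define x where "x = real r / real (M + r)"
    assume M: "2 * d + M1 + 1 \<le> M" and Q: "\<eta> \<le> poly Q (real r / real (M + r))"
    define e where "e = real (d * d) / (real M - real d)"
    have ge: "real M - real d \<ge> real M1" "real M - real d > 0" using M by linarith+
    have "K * (real d * real d) < \<eta> * real M1"
      using M1 assms by (simp add: field_simps)
    also have "\<dots> \<le> \<eta> * (real M - real d)" using ge assms by simp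
    finally have e: "K * e < \<eta>" unfolding e_def using ge by (simp add: field_simps)
    have "fps_nth (fps_of_poly Q * geom_pow (Suc M)) r
        = (\<Sum>i=0..r. coeff Q i * real ((M + r - i) choose (r - i)))"
      by (simp add: fps_mult_nth geom_pow_nth)
    \<comment> \<open>The default 0 beyond \<open>r\<close> agrees with \<open>fall_ratio\<close>
      and allows the range \<open>{..d}\<close>, which does not depend on \<open>r\<close>.\<close>
    also have "\<dots> = (\<Sum>i=0..r. coeff Q i * (if i \<le> r then real ((M + r - i) choose (r - i)) else 0))"
      by (intro sum.cong) auto
    also have "\<dots> = (\<Sum>i\<in>{0..r} \<inter> {..d}. coeff Q i * (if i \<le> r then real ((M + r - i) choose (r - i)) else 0))"
      by (intro sum.mono_neutral_right) (auto simp: d_def coeff_eq_0)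
    also have "\<dots> = (\<Sum>i\<le>d. coeff Q i * (if i \<le> r then real ((M + r - i) choose (r - i)) else 0))"
      by (intro sum.mono_neutral_left) auto
    also have "\<dots> = (\<Sum>i\<le>d. coeff Q i * (real ((M + r) choose r) * fall_ratio M r i))"
      using M by (intro sum.cong refl) (subst fall_ratio_binomial, auto)
    also have "\<dots> = real ((M + r) choose r) * (\<Sum>i\<le>d. coeff Q i * fall_ratio M r i)"
      by (simp add: sum_distrib_left mult_ac)
    finally have eq: "fps_nth (fps_of_poly Q * geom_pow (Suc M)) r
        = real ((M + r) choose r) * (\<Sum>i\<le>d. coeff Q i * fall_ratio M r i)" .
    have "\<bar>(\<Sum>i\<le>d. coeff Q i * fall_ratio M r i) - poly Q x\<bar>
        = \<bar>\<Sum>i\<le>d. coeff Q i * (fall_ratio M r i - x ^ i)\<bar>"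
      by (simp add: poly_altdef d_def sum_subtractf right_diff_distrib)
    also have "\<dots> \<le> (\<Sum>i\<le>d. \<bar>coeff Q i\<bar> * e)"
    proof (rule order.trans[OF sum_abs], rule sum_mono)
      fix i assume i: "i \<in> {..d}"
      have "\<bar>fall_ratio M r i - x ^ i\<bar> \<le> real (i * d) / (real M - real d)"
        unfolding x_def using M i by (intro fall_ratio_approx) auto
      also have "\<dots> \<le> e" unfolding e_def using ge i
        by (intro divide_right_mono of_nat_mono mult_le_mono1) auto
      finally show "\<bar>coeff Q i * (fall_ratio M r i - x ^ i)\<bar> \<le> \<bar>coeff Q i\<bar> * e"
        by (simp add: abs_mult mult_left_mono)
    qed
    also have "\<dots> = K * e" by (simp add: K_def sum_distrib_right)
    finally have "(\<Sum>i\<le>d. coeff Q i * fall_ratio M r i) > 0"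
      using e Q unfolding x_def by linarith
    then show "0 < fps_nth (fps_of_poly Q * geom_pow (Suc M)) r" unfolding eq by simp
  qed
qed

section \<open>The linear functional and the signs of its weights\<close>

definition dual_poly :: "nat \<Rightarrow> real \<Rightarrow> real poly" where
  "dual_poly m R = phi8 ^ m * chi12 * (phi8 ^ 3 - smult R psi24)"

text \<open>The vanishing coefficient at \<open>j + 1\<close> minus \<open>R\<close> times the one
  at \<open>j\<close>. The latter is multiplied by \<open>z\<close> so that both are read at
  \<open>z ^ (j + 1)\<close>, and \<open>z * (1 - z) ^ 4 = psi24\<close> brings them to the common
  power \<open>geom_pow (4 * j + 5)\<close>.\<close>

lemma oct_invariant_dual:
  assumes "oct_invariant N f" "N < 3 * j"
  shows "(\<Sum>k=0..Suc j. coeff f k *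
            fps_nth (fps_of_poly (dual_poly (3 * j - N - 1) R) * geom_pow (4 * j + 5)) (Suc j - k)) = 0"
proof -
  define m where "m = 3 * j - N - 1"
  define A where "A = fps_of_poly (f * phi8 ^ m * chi12)"
  have 1: "fps_nth (A * geom_pow (4 * j + 1)) j = 0"
    using oct_invariant_coeff_vanishes[OF assms] by (simp add: A_def m_def)
  have "3 * Suc j - N - 1 = m + 3" using assms by (simp add: m_def)
  then have 2: "fps_nth (fps_of_poly (f * phi8 ^ (m + 3) * chi12) * geom_pow (4 * j + 5)) (Suc j) = 0"
    using oct_invariant_coeff_vanishes[OF assms(1), of "Suc j"] assms(2) by (simp add: eval_nat_numeral)
  have psi: "fps_of_poly psi24 = fps_X * (1 - fps_X) ^ 4"
    unfolding psi24_def by (simp add: fps_of_poly_mult fps_of_poly_power fps_of_poly_pCons)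
  have g: "geom_pow (4 * j + 5) * (1 - fps_X) ^ 4 = geom_pow (4 * j + 1)"
    using geom_pow_mult[of 4 "4 * j + 1"] by (simp add: add_ac)
  have "fps_of_poly f * (fps_of_poly (dual_poly m R) * geom_pow (4 * j + 5))
      = fps_of_poly (f * phi8 ^ (m + 3) * chi12) * geom_pow (4 * j + 5)
        - fps_const R * (fps_X * (A * (geom_pow (4 * j + 5) * (1 - fps_X) ^ 4)))"
    unfolding dual_poly_def A_def
    by (simp add: fps_of_poly_mult fps_of_poly_diff fps_of_poly_smult psi power_add algebra_simps)
  then have "fps_nth (fps_of_poly f * (fps_of_poly (dual_poly m R) * geom_pow (4 * j + 5))) (Suc j) = 0"
    using 1 2 unfolding g by simp
  then show ?thesis unfolding m_def by (simp add: fps_mult_nth)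
qed

text \<open>Sharp enough to place \<open>(3 * s - 2) / (3 * s + 2)\<close> between 0 and
  \<open>1 / 500\<close>; the lower bound has to exceed \<open>2 / 3\<close>.\<close>

lemma fourth_root_fifth_bounds:
  fixes s :: real
  assumes "s > 0" "s ^ 4 = 1 / 5"
  shows "667 / 1000 < s" "s < 669 / 1000"
proof -
  show "667 / 1000 < s"
  proof (rule ccontr)
    assume "\<not> ?thesis"
    then have "s ^ 4 \<le> (667 / 1000) ^ 4" using assms by (intro power_mono) auto
    then show False using assms by (simp add: power_divide)
  qed
  show "s < 669 / 1000"
  proof (rule ccontr)
    assume "\<not> ?thesis"
    then have "(669 / 1000) ^ 4 \<le> s ^ 4" using assms by (intro power_mono) auto
    then show False using assms by (simp add: power_divide)
  qed
qed

text \<open>The invariant function \<open>phi8 ^ 3 / psi24\<close> minus its value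
  \<open>3456 / 5\<close> at \<open>1 / 5\<close>, multiplied by \<open>psi24\<close> to stay
  polynomial at 0.\<close>

definition hauptmodul_gap :: "real \<Rightarrow> real" where
  "hauptmodul_gap z = poly phi8 z ^ 3 - 3456 / 5 * poly psi24 z"

lemma hauptmodul_gap_fifth: "hauptmodul_gap (1 / 5) = 0"
  by (simp add: hauptmodul_gap_def poly_phi8 poly_psi24 power_divide)

text \<open>
  \<open>phi8 ^ 3 / psi24\<close> is invariant, so \<open>1 / 5 = s ^ 4\<close> and its image under the substitution give it
  the same value; for this particular \<open>s\<close> the image is \<open>(3 s - 2) / (3 s + 2)\<close>.
\<close>
lemma hauptmodul_gap_zero:
  fixes s :: real
  assumes "s > 0" "s ^ 4 = 1 / 5"
  shows "hauptmodul_gap ((3 * s - 2) / (3 * s + 2)) = 0"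
proof -
  define w where "w = ((1 - s) / (1 + s)) ^ 4"
  have ne: "1 + s \<noteq> 0" using assms by simp
  have "(1 - s) ^ 4 * (3 * s + 2) - (1 + s) ^ 4 * (3 * s - 2) = 4 - 20 * s ^ 4" by (simp add: eval_nat_numeral algebra_simps)
  then have "(1 - s) ^ 4 * (3 * s + 2) = (1 + s) ^ 4 * (3 * s - 2)" using assms by simp
  then have w: "(3 * s - 2) / (3 * s + 2) = w"
    unfolding w_def using assms ne by (simp add: power_divide field_simps)
  have "(1 + s) ^ 24 * poly phi8 w ^ 3 = ((1 + s) ^ 8 * poly phi8 w) ^ 3"
    by (simp add: power_mult_distrib flip: power_mult)
  also have "\<dots> = 16 ^ 3 * poly phi8 (1 / 5) ^ 3"
    using phi8_transform[OF ne] assms unfolding w_def by (simp add: power_mult_distrib)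
  finally have 1: "(1 + s) ^ 24 * poly phi8 w ^ 3 = 16 ^ 3 * poly phi8 (1 / 5) ^ 3" .
  have 2: "(1 + s) ^ 24 * poly psi24 w = 16 ^ 3 * poly psi24 (1 / 5)"
    using psi24_transform[OF ne] assms unfolding w_def by simp
  have "(1 + s) ^ 24 * hauptmodul_gap w
      = (1 + s) ^ 24 * poly phi8 w ^ 3 - 3456 / 5 * ((1 + s) ^ 24 * poly psi24 w)"
    by (simp add: hauptmodul_gap_def algebra_simps)
  also have "\<dots> = 16 ^ 3 * hauptmodul_gap (1 / 5)"
    unfolding 1 2 hauptmodul_gap_def by (simp add: algebra_simps)
  finally show ?thesis using ne unfolding w hauptmodul_gap_fifth by simp
qed

text \<open>On this interval the derivative of \<open>phi8 ^ 3\<close> is at most 180, while that of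
  the subtracted term exceeds 450. The gap is thus positive to the left of its zero
  \<open>(3 * s - 2) / (3 * s + 2)\<close>.\<close>

lemma hauptmodul_gap_decreasing:
  assumes "0 \<le> x" "x < y" "y \<le> 1 / 500"
  shows "hauptmodul_gap y < hauptmodul_gap x"
proof (rule DERIV_neg_imp_decreasing[OF assms(2)])
  fix z assume "x \<le> z" "z \<le> y"
  then have z: "0 \<le> z" "z \<le> 1 / 500" using assms by auto
  let ?D = "3 * (1 + 14 * z + z ^ 2) ^ 2 * (14 + 2 * z) - 3456 / 5 * ((1 - z) ^ 4 - 4 * z * (1 - z) ^ 3)"
  have "(hauptmodul_gap has_real_derivative ?D) (at z)"
    unfolding hauptmodul_gap_def poly_phi8 poly_psi24
    by (auto intro!: derivative_eq_intros simp: field_simps)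
  moreover have "?D < 0"
  proof -
    have "z ^ 2 \<le> (1 / 500) ^ 2" using z by (intro power_mono) auto
    then have p: "0 \<le> 1 + 14 * z + z ^ 2" "1 + 14 * z + z ^ 2 \<le> 2" using z by (simp_all add: power_divide)
    have "3 * (1 + 14 * z + z ^ 2) ^ 2 * (14 + 2 * z) \<le> 3 * 2 ^ 2 * 15"
      using p z by (intro mult_mono power_mono) auto
    moreover have "(1 - z) ^ 3 \<ge> (9 / 10) ^ 3" using z by (intro power_mono) auto
    then have "(1 - z) ^ 3 * (1 - 5 * z) \<ge> (9 / 10) ^ 3 * (9 / 10)" using z by (intro mult_mono) auto
    moreover have "(1 - z) ^ 4 - 4 * z * (1 - z) ^ 3 = (1 - z) ^ 3 * (1 - 5 * z)" by (simp add: eval_nat_numeral algebra_simps)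
    ultimately show ?thesis by (simp add: power_divide)
  qed
  ultimately show "\<exists>D. (hauptmodul_gap has_real_derivative D) (at z) \<and> D < 0" by blast
qed

lemma poly_dual_poly:
  "poly (dual_poly m R) z = poly phi8 z ^ m * poly chi12 z * (hauptmodul_gap z - (R - 3456 / 5) * poly psi24 z)"
  by (simp add: dual_poly_def hauptmodul_gap_def algebra_simps)

text \<open>An exponent \<open>k\<close> stands for weight \<open>4 * k\<close> in length
  \<open>8 * N\<close>, so \<open>k / (2 * N)\<close> is the relative weight. Without such a
  \<open>k\<close>, the vanishing sum of \<open>oct_invariant_dual\<close> would have nonnegative
  terms and a positive one at \<open>k = 0\<close>.\<close>

theorem oct_invariant_min_weight:
  fixes \<epsilon> s :: real
  assumes s: "s > 0" "s ^ 4 = 1 / 5" and \<epsilon>: "\<epsilon> > 0"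
  shows "\<exists>N0. \<forall>N\<ge>N0. \<forall>f. oct_invariant N f \<longrightarrow> (\<forall>k. coeff f k \<ge> 0) \<longrightarrow> coeff f 0 > 0 \<longrightarrow>
           (\<exists>k\<ge>2. coeff f k > 0 \<and> real k < ((1 - s) / 2 + \<epsilon>) * (2 * real N))"
proof -
  define z0 where "z0 = (3 * s - 2) / (3 * s + 2)"
  note sb = fourth_root_fifth_bounds[OF s]
  have z0: "0 < z0" "z0 < 1 / 500"
    using sb by (simp_all add: z0_def field_simps)
  \<comment> \<open>Staying strictly left of \<open>z0\<close> keeps the gap at least
    \<open>h > 0\<close> on \<open>[0, x1]\<close>; the distance \<open>\<epsilon> / 2\<close> is
    affordable given the slack in the weight.\<close>
  define x1 where "x1 = z0 - min z0 (\<epsilon> / 2)"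
  have x1: "0 \<le> x1" "x1 < z0" "z0 - x1 \<le> \<epsilon> / 2" using z0 \<epsilon> by (auto simp: x1_def)
  define h where "h = hauptmodul_gap x1"
  have h: "h > 0"
    using hauptmodul_gap_decreasing[of x1 z0] x1 z0 hauptmodul_gap_zero[OF s] by (simp add: h_def z0_def)
  \<comment> \<open>Half of the margin \<open>h\<close> is spent: on \<open>[0, x1]\<close> the
    other half survives because \<open>psi24 \<le> 1\<close>, while at \<open>1 / 5\<close>, where
    the gap is zero, the last factor becomes negative like \<open>chi12\<close>, so that the product
    is positive.\<close>
  define R where "R = 3456 / 5 + h / 2"
  define Q where "Q m = dual_poly m R" for m
  have pQ: "poly (Q m) z = poly phi8 z ^ m * poly chi12 z * (hauptmodul_gap z - h / 2 * poly psi24 z)" for m z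
    by (simp add: Q_def poly_dual_poly R_def)
  have small: "poly (Q m) z \<ge> h / 4" if "0 \<le> z" "z \<le> x1" for m z
  proof -
    have z: "0 \<le> z" "z \<le> 1 / 500" using that x1 z0 by auto
    have "hauptmodul_gap z \<ge> h"
      using hauptmodul_gap_decreasing[of z x1] that x1 z0 by (cases "z = x1") (auto simp: h_def)
    moreover have "poly psi24 z \<le> 1"
      using z by (auto simp: poly_psi24 intro!: mult_le_one power_le_one)
    then have "h / 2 * poly psi24 z \<le> h / 2 * 1" using h by (intro mult_left_mono) auto
    ultimately have 1: "hauptmodul_gap z - h / 2 * poly psi24 z \<ge> h / 2" by simp
    have 2: "poly phi8 z ^ m \<ge> 1" using z by (simp add: poly_phi8)
    have "z ^ 2 \<le> (1 / 500) ^ 2" using z by (intro power_mono) auto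
    then have "z ^ 2 \<le> 1 / 250000" by (simp add: power_divide)
    moreover have "z ^ 3 \<ge> 0" using z by simp
    ultimately have 3: "poly chi12 z \<ge> 1 / 2" using z unfolding poly_chi12 by linarith
    have "1 * (1 / 2) * (h / 2) \<le> poly phi8 z ^ m * poly chi12 z * (hauptmodul_gap z - h / 2 * poly psi24 z)"
      using 1 2 3 h by (intro mult_mono) auto
    then show ?thesis unfolding pQ by simp
  qed
  have fifth: "poly (Q m) (1 / 5) > 0" for m
  proof -
    have "poly psi24 (1 / 5 :: real) > 0" by (simp add: poly_psi24)
    then have "hauptmodul_gap (1 / 5) - h / 2 * poly psi24 (1 / 5) < 0"
      using h by (simp add: hauptmodul_gap_fifth)
    moreover have "poly chi12 (1 / 5 :: real) < 0" by (simp add: poly_chi12 power_divide)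
    moreover have "poly phi8 (1 / 5 :: real) > 0" by (simp add: poly_phi8 power_divide)
    ultimately show ?thesis unfolding pQ by (simp add: mult_pos_neg mult_neg_neg)
  qed
  \<comment> \<open>Half of the value at \<open>1 / 5\<close>, since for \<open>k = 1\<close> the
    saddle point only tends to \<open>1 / 5\<close>.\<close>
  define \<eta> where "\<eta> m = min (h / 4) (poly (Q m) (1 / 5) / 2)" for m
  have \<eta>: "\<eta> m > 0" for m using fifth[of m] h by (simp add: \<eta>_def)
  have "\<forall>m. \<exists>M0. \<forall>M\<ge>M0. \<forall>r. \<eta> m \<le> poly (Q m) (real r / real (M + r)) \<longrightarrow>
      0 < fps_nth (fps_of_poly (Q m) * geom_pow (Suc M)) r"
    using coeff_pos_of_saddle[OF \<eta>] by blast
  from choice[OF this] obtain M0 where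
    M0: "\<And>m M r. M0 m \<le> M \<Longrightarrow> \<eta> m \<le> poly (Q m) (real r / real (M + r)) \<Longrightarrow>
      0 < fps_nth (fps_of_poly (Q m) * geom_pow (Suc M)) r" by blast
  have "\<forall>m. \<forall>\<^sub>F j in sequentially. poly (Q m) (1 / 5) / 2 < poly (Q m) (real j / real (4 * j + 4 + j))"
  proof
    fix m
    have "(\<lambda>j. real j / real (4 * j + 4 + j)) \<longlonglongrightarrow> 1 / 5"
      by real_asymp
    then have "(\<lambda>j. poly (Q m) (real j / real (4 * j + 4 + j))) \<longlonglongrightarrow> poly (Q m) (1 / 5)"
      by (rule isCont_tendsto_compose[rotated]) simp
    then show "\<forall>\<^sub>F j in sequentially. poly (Q m) (1 / 5) / 2 < poly (Q m) (real j / real (4 * j + 4 + j))"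
      using fifth[of m] by (intro order_tendstoD) auto
  qed
  then have "\<forall>m. \<exists>j0. \<forall>j\<ge>j0. poly (Q m) (1 / 5) / 2 < poly (Q m) (real j / real (4 * j + 4 + j))"
    unfolding eventually_sequentially .
  from choice[OF this] obtain j0 where
    j0: "\<And>m j. j0 m \<le> j \<Longrightarrow> poly (Q m) (1 / 5) / 2 < poly (Q m) (real j / real (4 * j + 4 + j))" by blast
  \<comment> \<open>With \<open>J = j + 1\<close>, the rounding \<open>N \<ge> 3 * J - 6\<close>
    costs \<open>12 * a\<close> for \<open>a = (1 - s) / 2 + \<epsilon>\<close>; beyond
    \<open>J0\<close> half of the margin \<open>6 * \<epsilon> * J\<close> absorbs it.\<close>
  obtain J0 :: nat where J0: "real J0 > 12 * ((1 - s) / 2 + \<epsilon>) / (3 * \<epsilon>)" using reals_Archimedean2 by blast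
  \<comment> \<open>The least \<open>j\<close> with \<open>N < 3 * j\<close> will be used, so
    \<open>m = 3 * j - N - 1\<close> is 0, 1 or 2 and one threshold serves all cases.\<close>
  define B where "B = J0 + (\<Sum>m<3. M0 m + j0 m)"
  have B: "M0 m \<le> B \<and> j0 m \<le> B" if "m < 3" for m
  proof -
    have "M0 m + j0 m \<le> (\<Sum>m<3. M0 m + j0 m)"
      using that by (intro member_le_sum) auto
    then show ?thesis by (simp add: B_def)
  qed
  show ?thesis
  proof (rule exI[of _ "3 * B"], intro allI impI, rule ccontr)
    fix N f
    assume N: "3 * B \<le> N" and f: "oct_invariant N f" "\<forall>k. coeff f k \<ge> 0" "coeff f 0 > 0"
      and no: "\<not> (\<exists>k\<ge>2. coeff f k > 0 \<and> real k < ((1 - s) / 2 + \<epsilon>) * (2 * real N))"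
    define j where "j = N div 3 + 1"
    define m where "m = 3 * j - N - 1"
    have j: "N < 3 * j" "B \<le> j" "3 * j \<le> N + 3" "m < 3" using N by (auto simp: j_def m_def)
    define L where "L k = fps_nth (fps_of_poly (Q m) * geom_pow (4 * j + 5)) (Suc j - k)" for k
    have sum0: "(\<Sum>k=0..Suc j. coeff f k * L k) = 0"
      using oct_invariant_dual[OF f(1) j(1)] by (simp add: L_def Q_def m_def)
    have Lpos: "L k > 0" if "\<eta> m \<le> poly (Q m) (real (Suc j - k) / real (4 * j + 4 + (Suc j - k)))" for k
    proof -
      have "M0 m \<le> 4 * j + 4" using B[OF j(4)] j(2) by linarith
      from M0[OF this that] show ?thesis by (simp add: L_def eval_nat_numeral)
    qed
    have L0: "L 0 > 0"
    proof (rule Lpos)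
      have "real (Suc j - 0) / real (4 * j + 4 + (Suc j - 0)) = 1 / 5" by (simp add: field_simps)
      then show "\<eta> m \<le> poly (Q m) (real (Suc j - 0) / real (4 * j + 4 + (Suc j - 0)))"
        using fifth[of m] unfolding \<eta>_def by (simp only:)
    qed
    have L1: "L 1 > 0"
    proof (rule Lpos)
      have "j0 m \<le> j" using B[OF j(4)] j(2) by simp
      from j0[OF this] show "\<eta> m \<le> poly (Q m) (real (Suc j - 1) / real (4 * j + 4 + (Suc j - 1)))"
        by (simp add: \<eta>_def)
    qed
    have Lk: "L k > 0" if k: "2 \<le> k" "k \<le> Suc j" "coeff f k > 0" for k
    proof (rule Lpos)
      define a where "a = (1 - s) / 2 + \<epsilon>"
      define J where "J = real (Suc j)"
      define x where "x = real (Suc j - k) / real (4 * j + 4 + (Suc j - k))"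
      have "1 - s > 0" using sb(2) by simp
      then have a: "a > 0" unfolding a_def using \<epsilon> by (intro add_pos_pos divide_pos_pos) simp_all
      have J: "J \<ge> real J0" using j by (simp add: J_def B_def)
      have "real k \<ge> a * (2 * real N)" using no k by (auto simp: a_def)
      moreover have "real N \<ge> 3 * J - 6" using j(3) by (simp add: J_def)
      then have "a * (2 * real N) \<ge> a * (2 * (3 * J - 6))" using a by (intro mult_left_mono) auto
      moreover have "3 * \<epsilon> * J \<ge> 12 * a"
      proof -
        have "12 * a < 3 * \<epsilon> * real J0" using J0 \<epsilon> by (simp add: a_def field_simps)
        also have "\<dots> \<le> 3 * \<epsilon> * J" using J \<epsilon> by simp
        finally show ?thesis by simp
      qed
      moreover have "a * (2 * (3 * J - 6)) = (3 - 3 * s + 3 * \<epsilon>) * J + (3 * \<epsilon> * J - 12 * a)"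
        by (simp add: a_def field_simps)
      ultimately have k6: "real k \<ge> (3 - 3 * s + 3 * \<epsilon>) * J" by linarith
      \<comment> \<open>The saddle point for \<open>k\<close> is
        \<open>(J - k) / (5 * J - k)\<close>; this identity says that it equals \<open>z0\<close> at
        the critical ratio \<open>k / J = 3 - 3 * s\<close>.\<close>
      have s6: "(3 - 3 * s) * (1 - z0) = 1 - 5 * z0"
        using s by (simp add: z0_def field_simps)
      have "(3 - 3 * s + 3 * \<epsilon>) * (1 - x1) \<ge> 1 - 5 * x1"
      proof -
        \<comment> \<open>Moving from \<open>z0\<close> to \<open>x1\<close> costs at most
          \<open>5 / 2 * \<epsilon>\<close>, and the slack contributes at least
          \<open>27 / 10 * \<epsilon>\<close>.\<close>
        have "(3 - 3 * s + 3 * \<epsilon>) * (1 - x1) - (1 - 5 * x1)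
            = (3 - 3 * s) * (1 - z0) - (1 - 5 * z0) + 3 * \<epsilon> * (1 - x1) - (2 + 3 * s) * (z0 - x1)"
          by (simp add: algebra_simps)
        moreover have "3 * \<epsilon> * (1 - x1) \<ge> 3 * \<epsilon> * (9 / 10)" using x1 z0 \<epsilon> by (intro mult_left_mono) auto
        moreover have "(2 + 3 * s) * (z0 - x1) \<le> 5 * (\<epsilon> / 2)" using sb x1 by (intro mult_mono) auto
        ultimately show ?thesis using s6 \<epsilon> by linarith
      qed
      then have "(1 - 5 * x1) * J \<le> (3 - 3 * s + 3 * \<epsilon>) * (1 - x1) * J" by (intro mult_right_mono) (auto simp: J_def)
      also have "\<dots> = ((3 - 3 * s + 3 * \<epsilon>) * J) * (1 - x1)" by simp
      also have "\<dots> \<le> real k * (1 - x1)" using k6 x1 z0 by (intro mult_right_mono) auto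
      finally have "J - real k \<le> x1 * (5 * J - real k)" by (simp add: algebra_simps)
      moreover have "x = (J - real k) / (5 * J - real k)" "5 * J - real k > 0"
        using k by (simp_all add: x_def J_def of_nat_diff)
      ultimately have "x \<le> x1" by (simp add: pos_divide_le_eq)
      moreover have "0 \<le> x" by (simp add: x_def)
      ultimately have "h / 4 \<le> poly (Q m) x" by (intro small)
      then show "\<eta> m \<le> poly (Q m) (real (Suc j - k) / real (4 * j + 4 + (Suc j - k)))"
        by (simp add: \<eta>_def x_def)
    qed
    have nonneg: "coeff f k * L k \<ge> 0" if "k \<le> Suc j" for k
    proof (cases "coeff f k > 0")
      case True
      then have "L k > 0" using L0 L1 Lk that by (cases "k = 0"; cases "k = 1") auto
      then show ?thesis using True by simp
    next
      case False
      then have "coeff f k = 0" using f(2) by (metis order_less_le)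
      then show ?thesis by simp
    qed
    have "0 < coeff f 0 * L 0" using f(3) L0 by simp
    also have "\<dots> \<le> (\<Sum>k=0..Suc j. coeff f k * L k)"
      using nonneg by (intro member_le_sum) auto
    finally show False using sum0 by simp
  qed
qed

section \<open>Doubly-even binary codes\<close>

text \<open>Binary words are represented by their supports, with symmetric difference as addition.
  Complex arguments permit the substitution of \<open>\<i> * y\<close>.\<close>

definition weight_enum :: "nat \<Rightarrow> nat set set \<Rightarrow> complex \<Rightarrow> complex \<Rightarrow> complex" where
  "weight_enum n D x y = (\<Sum>c\<in>D. x ^ (n - card c) * y ^ card c)"

definition binary_dual :: "nat \<Rightarrow> nat set set \<Rightarrow> nat set set" where
  "binary_dual n D = {u. u \<subseteq> {..<n} \<and> (\<forall>c\<in>D. even (card (u \<inter> c)))}"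

lemma card_sym_diff:
  assumes "finite A" "finite B"
  shows "card (sym_diff A B) + 2 * card (A \<inter> B) = card A + card B"
proof -
  have "card A = card (A - B) + card (A \<inter> B)"
    using assms by (metis card_Diff_subset_Int card_Int_Diff add.commute)
  moreover have "card B = card (B - A) + card (A \<inter> B)"
    using assms by (metis card_Int_Diff add.commute Int_commute)
  moreover have "card (sym_diff A B) = card (A - B) + card (B - A)"
    using assms by (intro card_Un_disjoint) auto
  ultimately show ?thesis by simp
qed

locale binary_code =
  fixes n :: nat and D :: "nat set set"
  assumes words: "D \<subseteq> Pow {..<n}"
    and zero: "{} \<in> D"
    and add: "\<And>a b. a \<in> D \<Longrightarrow> b \<in> D \<Longrightarrow> sym_diff a b \<in> D"
begin

lemma finite_D: "finite D"
  using words by (rule finite_subset) simp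

lemma finite_word: "c \<in> D \<Longrightarrow> finite c"
  using words by (auto intro: finite_subset)

lemma card_word_le: "c \<in> D \<Longrightarrow> card c \<le> n"
  using words card_mono[of "{..<n}" c] by auto

text \<open>Orthogonality of characters: translation by a word meeting \<open>u\<close> oddly flips
  the sign of every term.\<close>

lemma character_sum:
  assumes "finite u"
  shows "(\<Sum>c\<in>D. (-1 :: complex) ^ card (u \<inter> c)) =
           (if \<forall>c\<in>D. even (card (u \<inter> c)) then of_nat (card D) else 0)"
proof (cases "\<forall>c\<in>D. even (card (u \<inter> c))")
  case True
  then have "(\<Sum>c\<in>D. (-1 :: complex) ^ card (u \<inter> c)) = (\<Sum>c\<in>D. 1)" by (intro sum.cong) auto
  then show ?thesis using True by simp
next
  case False
  then obtain a where a: "a \<in> D" "odd (card (u \<inter> a))" by blast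
  let ?S = "\<Sum>c\<in>D. (-1 :: complex) ^ card (u \<inter> c)"
  have inv: "sym_diff a (sym_diff a c) = c" for c by blast
  have "?S = (\<Sum>c\<in>D. (-1) ^ card (u \<inter> sym_diff a c))"
    by (rule sum.reindex_bij_witness[of _ "sym_diff a" "sym_diff a"]) (simp_all only: inv add[OF a(1)])
  also have "\<dots> = (\<Sum>c\<in>D. - ((-1) ^ card (u \<inter> c)))"
  proof (intro sum.cong refl)
    fix c assume "c \<in> D"
    have "u \<inter> sym_diff a c = sym_diff (u \<inter> a) (u \<inter> c)" by blast
    then have "card (u \<inter> sym_diff a c) + 2 * card ((u \<inter> a) \<inter> (u \<inter> c)) = card (u \<inter> a) + card (u \<inter> c)"
      using card_sym_diff[of "u \<inter> a" "u \<inter> c"] assms by simp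
    then have "even (card (u \<inter> sym_diff a c)) \<longleftrightarrow> odd (card (u \<inter> c))"
      using a(2) by presburger
    then show "(-1 :: complex) ^ card (u \<inter> sym_diff a c) = - ((-1) ^ card (u \<inter> c))"
      by (cases "even (card (u \<inter> c))") auto
  qed
  also have "\<dots> = - ?S" by (simp add: sum_negf)
  finally have "?S = 0" by simp
  then show ?thesis using False by (simp only: if_False)
qed

text \<open>Expanding the product over the coordinates gives a sum over all \<open>u\<close>; after
  exchanging the sums, \<open>character_sum\<close> selects the dual words.\<close>

theorem MacWilliams:
  "weight_enum n D (x + y) (x - y) = of_nat (card D) * weight_enum n (binary_dual n D) x y"
proof -
  have expand: "(x + y) ^ (n - card c) * (x - y) ^ card c =
      (\<Sum>u\<in>Pow {..<n}. (-1) ^ card (u \<inter> c) * (x ^ (n - card u) * y ^ card u))" if "c \<in> D" for c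
  proof -
    have c: "c \<subseteq> {..<n}" using that words by auto
    have "(\<Prod>i<n. (if i \<in> c then - y else y) + x)
        = (\<Prod>i\<in>{..<n} - c. (if i \<in> c then - y else y) + x) * (\<Prod>i\<in>c. (if i \<in> c then - y else y) + x)"
      by (rule prod.subset_diff[OF c]) simp
    also have "(\<Prod>i\<in>{..<n} - c. (if i \<in> c then - y else y) + x) = (x + y) ^ (n - card c)"
      using c by (simp add: card_Diff_subset finite_subset add.commute)
    also have "(\<Prod>i\<in>c. (if i \<in> c then - y else y) + x) = (x - y) ^ card c"
      by simp
    finally have "(x + y) ^ (n - card c) * (x - y) ^ card c = (\<Prod>i<n. (if i \<in> c then - y else y) + x)" ..
    also have "\<dots> = (\<Sum>u\<in>Pow {..<n}. (\<Prod>i\<in>u. if i \<in> c then - y else y) * (\<Prod>i\<in>{..<n} - u. x))"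
      by (rule prod_add) simp
    also have "\<dots> = (\<Sum>u\<in>Pow {..<n}. (-1) ^ card (u \<inter> c) * (x ^ (n - card u) * y ^ card u))"
    proof (intro sum.cong refl)
      fix u assume "u \<in> Pow {..<n}"
      then have u: "u \<subseteq> {..<n}" "finite u" by (auto intro: finite_subset)
      have "(\<Prod>i\<in>u. if i \<in> c then - y else y) = (\<Prod>i\<in>u. (if i \<in> c then -1 else 1) * y)"
        by (intro prod.cong) auto
      also have "\<dots> = (\<Prod>i\<in>u. if i \<in> c then -1 else 1) * y ^ card u"
        by (simp add: prod.distrib)
      also have "(\<Prod>i\<in>u. if i \<in> c then -1 else 1 :: complex) = (-1) ^ card (u \<inter> c)"
        using u by (simp add: prod.If_cases Int_def)
      finally show "(\<Prod>i\<in>u. if i \<in> c then - y else y) * (\<Prod>i\<in>{..<n} - u. x)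
          = (-1) ^ card (u \<inter> c) * (x ^ (n - card u) * y ^ card u)"
        using u by (simp add: card_Diff_subset)
    qed
    finally show ?thesis .
  qed
  have "weight_enum n D (x + y) (x - y)
      = (\<Sum>c\<in>D. \<Sum>u\<in>Pow {..<n}. (-1) ^ card (u \<inter> c) * (x ^ (n - card u) * y ^ card u))"
    unfolding weight_enum_def by (intro sum.cong refl expand)
  also have "\<dots> = (\<Sum>u\<in>Pow {..<n}. (\<Sum>c\<in>D. (-1) ^ card (u \<inter> c)) * (x ^ (n - card u) * y ^ card u))"
    by (subst sum.swap) (simp add: sum_distrib_right)
  also have "\<dots> = (\<Sum>u\<in>Pow {..<n}. if \<forall>c\<in>D. even (card (u \<inter> c))
        then of_nat (card D) * (x ^ (n - card u) * y ^ card u) else 0)"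
  proof (intro sum.cong refl)
    fix u assume "u \<in> Pow {..<n}"
    then have "finite u" by (auto intro: finite_subset)
    from character_sum[OF this] show "(\<Sum>c\<in>D. (-1) ^ card (u \<inter> c)) * (x ^ (n - card u) * y ^ card u) =
      (if \<forall>c\<in>D. even (card (u \<inter> c)) then of_nat (card D) * (x ^ (n - card u) * y ^ card u) else 0)"
      by simp
  qed
  also have "\<dots> = (\<Sum>u\<in>binary_dual n D. of_nat (card D) * (x ^ (n - card u) * y ^ card u))"
    by (subst sum.inter_filter[symmetric]) (auto simp: binary_dual_def intro!: sum.cong)
  finally show ?thesis by (simp add: weight_enum_def sum_distrib_left)
qed

lemma weight_enum_scale: "weight_enum n D (t * x) (t * y) = t ^ n * weight_enum n D x y"
proof -
  have "(t * x) ^ (n - card c) * (t * y) ^ card c = t ^ n * (x ^ (n - card c) * y ^ card c)" if "c \<in> D" for c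
  proof -
    have "t ^ n = t ^ (n - card c) * t ^ card c"
      using card_word_le[OF that] by (simp flip: power_add)
    then show ?thesis by (simp add: power_mult_distrib)
  qed
  then show ?thesis
    unfolding weight_enum_def sum_distrib_left by (intro sum.cong refl)
qed

end

section \<open>The octahedral orbit sum of a doubly-even code\<close>

locale doubly_even_code = binary_code "8 * N" D for N D +
  assumes doubly_even: "\<And>c. c \<in> D \<Longrightarrow> 4 dvd card c"
begin

abbreviation "W \<equiv> weight_enum (8 * N) D"

lemma weight_enum_ii: "W x (\<i> * y) = W x y" "W x (- (\<i> * y)) = W x y"
proof -
  have "\<i> ^ card c = 1 \<and> (- \<i>) ^ card c = 1" if "c \<in> D" for c
    using doubly_even[OF that] by (auto elim!: dvdE simp: power_mult)
  moreover have "(- (\<i> * y)) ^ k = (- \<i>) ^ k * y ^ k" for k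
    by (simp flip: power_mult_distrib)
  ultimately show "W x (\<i> * y) = W x y" "W x (- (\<i> * y)) = W x y"
    unfolding weight_enum_def by (auto intro!: sum.cong simp: power_mult_distrib)
qed

lemma self_orthogonal:
  assumes "a \<in> D" "b \<in> D"
  shows "even (card (a \<inter> b))"
proof -
  have "card (sym_diff a b) + 2 * card (a \<inter> b) = card a + card b"
    using assms by (intro card_sym_diff finite_word)
  moreover have "4 dvd card (sym_diff a b)" "4 dvd card a" "4 dvd card b"
    using assms add doubly_even by blast+
  ultimately show ?thesis by presburger
qed

lemma word_in_dual: "c \<in> D \<Longrightarrow> c \<in> binary_dual (8 * N) D"
  using words self_orthogonal by (auto simp: binary_dual_def)

text \<open>The full set is in the dual because all words have even weight. Complements account for
  the terms of \<open>W y x\<close> in the orbit sum.\<close>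

lemma complement_in_dual:
  assumes "c \<in> D"
  shows "{..<8 * N} - c \<in> binary_dual (8 * N) D"
proof -
  have "even (card (({..<8 * N} - c) \<inter> b))" if b: "b \<in> D" for b
  proof -
    have "({..<8 * N} - c) \<inter> b = b - c" using b words by auto
    moreover have "card b = card (b \<inter> c) + card (b - c)"
      using finite_word[OF b] by (metis card_Int_Diff)
    moreover have "even (card (b \<inter> c))" "4 dvd card b"
      using self_orthogonal[OF b assms] doubly_even[OF b] .
    ultimately show ?thesis by presburger
  qed
  then show ?thesis by (auto simp: binary_dual_def)
qed

text \<open>
  Up to a constant this is the sum of the images of \<open>W\<close> under the group generated by
  \<open>(x, y) \<mapsto> (x + y, x - y) / sqrt 2\<close> and \<open>(x, y) \<mapsto> (x, \<i> y)\<close>, which fixes the weight enumerators of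
  doubly-even self-dual codes. By the MacWilliams identity its last four terms together count
  the words of the dual code with weight divisible by 4.
\<close>
definition orbit_sum :: "complex \<Rightarrow> complex \<Rightarrow> complex" where
  "orbit_sum x y = W x y + W y x
     + (W (x + y) (x - y) + W (x - y) (x + y) + W (x + \<i> * y) (x - \<i> * y) + W (x - \<i> * y) (x + \<i> * y)) / 16 ^ N"

lemma orbit_sum_scale: "orbit_sum (t * x) (t * y) = t ^ (8 * N) * orbit_sum x y"
proof -
  have e: "t * x + t * y = t * (x + y)" "t * x - t * y = t * (x - y)"
    "t * x + \<i> * (t * y) = t * (x + \<i> * y)" "t * x - \<i> * (t * y) = t * (x - \<i> * y)"
    by (simp_all add: algebra_simps)
  show ?thesis unfolding orbit_sum_def e weight_enum_scale by (simp add: algebra_simps add_divide_distrib)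
qed

text \<open>The substitution permutes the six summands: the first two trade places with the next
  two, and the last two with each other. The scalars \<open>1 + \<i>\<close> and
  \<open>1 - \<i>\<close> have eighth power 16, and stray units on the second argument are absorbed
  by \<open>weight_enum_ii\<close>.\<close>

lemma orbit_sum_transform: "orbit_sum (x + y) (x - y) = 16 ^ N * orbit_sum x y"
proof -
  define a where "a = (x + y) + \<i> * (x - y)"
  define b where "b = (x + y) - \<i> * (x - y)"
  have a: "a = (1 + \<i>) * (x - \<i> * y)" by (simp add: a_def algebra_simps)
  have b: "b = (1 + \<i>) * (- (\<i> * (x + \<i> * y)))" by (simp add: b_def algebra_simps)
  have "(1 + \<i>) ^ 8 = ((1 + \<i>) ^ 2) ^ 4" by (simp flip: power_mult)
  also have "(1 + \<i>) ^ 2 = 2 * \<i>" by (simp add: power2_eq_square algebra_simps)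
  also have "(2 * \<i>) ^ 4 = 16" by (simp add: power_mult_distrib)
  finally have s: "(1 + \<i>) ^ (8 * N) = 16 ^ N" by (simp add: power_mult)
  have ab: "W a b = 16 ^ N * W (x - \<i> * y) (x + \<i> * y)"
    unfolding a b weight_enum_scale s weight_enum_ii ..
  \<comment> \<open>A second factorisation, through \<open>1 - \<i>\<close>, moves the stray unit to
    \<open>a\<close>, which is the second argument in \<open>W b a\<close>.\<close>
  have a': "a = (1 - \<i>) * (\<i> * (x - \<i> * y))" by (simp add: a_def algebra_simps)
  have b': "b = (1 - \<i>) * (x + \<i> * y)" by (simp add: b_def algebra_simps)
  have "(1 - \<i>) ^ 8 = ((1 - \<i>) ^ 2) ^ 4" by (simp flip: power_mult)
  also have "(1 - \<i>) ^ 2 = - (2 * \<i>)" by (simp add: power2_eq_square algebra_simps)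
  also have "(- (2 * \<i>)) ^ 4 = 16" by (simp add: power_mult_distrib)
  finally have s': "(1 - \<i>) ^ (8 * N) = 16 ^ N" by (simp add: power_mult)
  have ba: "W b a = 16 ^ N * W (x + \<i> * y) (x - \<i> * y)"
    unfolding a' b' weight_enum_scale s' weight_enum_ii ..
  have two: "W (2 * u) (2 * v) = 16 ^ N * (16 ^ N * W u v)" for u v
    unfolding weight_enum_scale by (simp add: power_mult flip: power_mult_distrib mult.assoc)
  have e: "(x + y) + (x - y) = 2 * x" "(x + y) - (x - y) = 2 * y" by simp_all
  have "orbit_sum (x + y) (x - y) = W (x + y) (x - y) + W (x - y) (x + y)
      + (W (2 * x) (2 * y) + W (2 * y) (2 * x) + W a b + W b a) / 16 ^ N"
    unfolding orbit_sum_def e a_def b_def ..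
  also have "\<dots> = 16 ^ N * orbit_sum x y"
    unfolding two ab ba orbit_sum_def by (simp add: field_simps)
  finally show ?thesis .
qed

text \<open>The orbit sum in \<open>z = y ^ 4\<close> with its real coefficients explicit. The
  constant combines the MacWilliams factor with the 4 produced by filtering through the fourth roots
  of unity.\<close>

definition orbit_poly :: "real poly" where
  "orbit_poly = (\<Sum>c\<in>D. monom 1 (card c div 4) + monom 1 ((8 * N - card c) div 4))
     + (\<Sum>u | u \<in> binary_dual (8 * N) D \<and> 4 dvd card u. monom (4 * real (card D) / 16 ^ N) (card u div 4))"

lemma finite_dual: "finite (binary_dual (8 * N) D)"
  by (rule finite_subset[of _ "Pow {..<8 * N}"]) (auto simp: binary_dual_def)

lemma dual_sum_fourth_roots:
  fixes y :: complex
  shows "y ^ k + (- y) ^ k + (\<i> * y) ^ k + (- (\<i> * y)) ^ k = (if 4 dvd k then 4 * y ^ k else 0)"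
proof -
  have "y ^ k + (- y) ^ k + (\<i> * y) ^ k + (- (\<i> * y)) ^ k = y ^ k * (1 + (-1) ^ k + \<i> ^ k + (- \<i>) ^ k)"
  proof -
    have "(- y) ^ k = (-1) ^ k * y ^ k" "(- (\<i> * y)) ^ k = (- \<i>) ^ k * y ^ k"
      by (simp_all flip: power_mult_distrib)
    then show ?thesis by (simp add: algebra_simps power_mult_distrib)
  qed
  also have "1 + (-1) ^ k + \<i> ^ k + (- \<i>) ^ k = (if 4 dvd k then 4 else 0 :: complex)"
  proof -
    define q r where "q = k div 4" and "r = k mod 4"
    have k: "k = 4 * q + r" "r < 4" by (simp_all add: q_def r_def)
    have dvd: "4 dvd k \<longleftrightarrow> r = 0" by (simp add: r_def dvd_eq_mod_eq_0)
    have "r = 0 \<or> r = 1 \<or> r = 2 \<or> r = 3" using k(2) by linarith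
    then show ?thesis unfolding dvd unfolding k(1) power_add power_mult
      by (elim disjE) (simp_all add: power3_eq_cube)
  qed
  finally show ?thesis by simp
qed

lemma orbit_poly_eq: "of_real (poly orbit_poly (y ^ 4)) = orbit_sum 1 (of_real y)"
proof -
  let ?y = "of_real y :: complex"
  define V where "V = weight_enum (8 * N) (binary_dual (8 * N) D)"
  have dD: "4 * (card c div 4) = card c" "4 * ((8 * N - card c) div 4) = 8 * N - card c" if "c \<in> D" for c
    using doubly_even[OF that] by (auto simp: dvd_div_mult_self mult.commute dvd_diff_nat)
  \<comment> \<open>The last four terms take the shape \<open>W (1 + v) (1 - v)\<close> for the four
    \<open>v\<close> with \<open>v ^ 4 = y ^ 4\<close>, ready for
    \<open>MacWilliams\<close>.\<close>
  have "orbit_sum 1 ?y = W 1 ?y + W ?y 1 + (W (1 + ?y) (1 - ?y) + W (1 + - ?y) (1 - - ?y)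
      + W (1 + \<i> * ?y) (1 - \<i> * ?y) + W (1 + - (\<i> * ?y)) (1 - - (\<i> * ?y))) / 16 ^ N"
    unfolding orbit_sum_def by simp
  also have "\<dots> = W 1 ?y + W ?y 1 + of_nat (card D) / 16 ^ N * (V 1 ?y + V 1 (- ?y) + V 1 (\<i> * ?y) + V 1 (- (\<i> * ?y)))"
    unfolding MacWilliams V_def by (simp add: field_simps)
  also have "V 1 ?y + V 1 (- ?y) + V 1 (\<i> * ?y) + V 1 (- (\<i> * ?y))
      = (\<Sum>u\<in>binary_dual (8 * N) D. if 4 dvd card u then 4 * ?y ^ card u else 0)"
    unfolding V_def weight_enum_def sum.distrib[symmetric]
    by (intro sum.cong refl) (simp only: power_one mult_1 dual_sum_fourth_roots)
  also have "\<dots> = (\<Sum>u | u \<in> binary_dual (8 * N) D \<and> 4 dvd card u. 4 * ?y ^ card u)"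
    using finite_dual by (subst sum.inter_filter[symmetric]) (auto intro!: sum.cong)
  also have "W 1 ?y = (\<Sum>c\<in>D. of_real (poly (monom 1 (card c div 4)) (y ^ 4)))"
    unfolding weight_enum_def by (intro sum.cong refl) (simp add: poly_monom dD flip: power_mult)
  also have "W ?y 1 = (\<Sum>c\<in>D. of_real (poly (monom 1 ((8 * N - card c) div 4)) (y ^ 4)))"
    unfolding weight_enum_def by (intro sum.cong refl) (simp add: poly_monom dD flip: power_mult)
  also have "of_nat (card D) / 16 ^ N * (\<Sum>u | u \<in> binary_dual (8 * N) D \<and> 4 dvd card u. 4 * ?y ^ card u)
      = (\<Sum>u | u \<in> binary_dual (8 * N) D \<and> 4 dvd card u.
           of_real (poly (monom (4 * real (card D) / 16 ^ N) (card u div 4)) (y ^ 4)))"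
    unfolding sum_distrib_left by (intro sum.cong refl) (simp add: poly_monom flip: power_mult)
  finally show ?thesis
    unfolding orbit_poly_def by (simp add: poly_sum sum.distrib)
qed

lemma oct_invariant_orbit_poly: "oct_invariant N orbit_poly"
  unfolding oct_invariant_def
proof (intro conjI allI impI)
  have "degree (monom a (card c div 4)) \<le> 2 * N" if "c \<in> binary_dual (8 * N) D" for a :: real and c
  proof -
    have "card c \<le> 8 * N" using that card_mono[of "{..<8 * N}" c] by (auto simp: binary_dual_def)
    then have "card c div 4 \<le> 2 * N" by simp
    then show ?thesis using degree_monom_le[of a "card c div 4"] by simp
  qed
  moreover have "degree (monom (1::real) ((8 * N - k) div 4)) \<le> 2 * N" for k
    using degree_monom_le[of "1::real" "(8 * N - k) div 4"] by simp
  ultimately show "degree orbit_poly \<le> 2 * N"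
    unfolding orbit_poly_def
    by (intro degree_add_le degree_sum_le finite_D) (auto simp: finite_dual intro: word_in_dual)
  fix y :: real assume y: "y \<noteq> 0 \<and> y \<noteq> 1 \<and> y \<noteq> -1"
  define c where "c = (1 + of_real y :: complex)"
  have "1 + y \<noteq> 0" using y by auto
  then have c: "c \<noteq> 0" unfolding c_def by (metis of_real_1 of_real_add of_real_eq_0_iff)
  have "of_real ((1 + y) ^ (8 * N) * poly orbit_poly (((1 - y) / (1 + y)) ^ 4))
      = c ^ (8 * N) * orbit_sum 1 ((1 - of_real y) / c)"
    by (simp only: of_real_mult orbit_poly_eq) (simp add: c_def)
  also have "\<dots> = orbit_sum (c * 1) (c * ((1 - of_real y) / c))" unfolding orbit_sum_scale ..
  also have "\<dots> = orbit_sum (1 + of_real y) (1 - of_real y)" using c by (simp add: c_def)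
  also have "\<dots> = of_real (16 ^ N * poly orbit_poly (y ^ 4))"
    unfolding orbit_sum_transform by (simp add: orbit_poly_eq)
  finally show "(1 + y) ^ (8 * N) * poly orbit_poly (((1 - y) / (1 + y)) ^ 4) = 16 ^ N * poly orbit_poly (y ^ 4)"
    by (simp only: of_real_eq_iff)
qed

lemma coeff_orbit_poly:
  "coeff orbit_poly k = (\<Sum>c\<in>D. (if card c div 4 = k then 1 else 0) + (if (8 * N - card c) div 4 = k then 1 else 0))
     + (\<Sum>u | u \<in> binary_dual (8 * N) D \<and> 4 dvd card u. if card u div 4 = k then 4 * real (card D) / 16 ^ N else 0)"
  by (simp add: orbit_poly_def coeff_sum)

lemma coeff_orbit_poly_nonneg: "coeff orbit_poly k \<ge> 0"
  unfolding coeff_orbit_poly by (intro add_nonneg_nonneg sum_nonneg) auto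

lemma coeff_orbit_poly_0: "coeff orbit_poly 0 > 0"
proof -
  have "1 \<le> (if card ({} :: nat set) div 4 = 0 then 1 else 0 :: real) + (if (8 * N - card ({} :: nat set)) div 4 = 0 then 1 else 0)"
    by simp
  also have "\<dots> \<le> (\<Sum>c\<in>D. (if card c div 4 = 0 then 1 else 0 :: real) + (if (8 * N - card c) div 4 = 0 then 1 else 0))"
    using zero finite_D by (intro member_le_sum) auto
  also have "\<dots> \<le> coeff orbit_poly 0"
    unfolding coeff_orbit_poly by (simp add: sum_nonneg)
  finally show ?thesis by simp
qed

lemma coeff_orbit_poly_pos:
  assumes "coeff orbit_poly k > 0"
  obtains u where "u \<in> binary_dual (8 * N) D" "card u = 4 * k"
proof -
  have "\<exists>u\<in>binary_dual (8 * N) D. card u = 4 * k"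
  proof (rule ccontr)
    assume none: "\<not> ?thesis"
    have "\<not> card c div 4 = k \<and> \<not> (8 * N - card c) div 4 = k" if c: "c \<in> D" for c
    proof -
      have "c \<in> binary_dual (8 * N) D" "card c = 4 * (card c div 4)"
        using word_in_dual[OF c] doubly_even[OF c] by auto
      moreover have "card ({..<8 * N} - c) = 8 * N - card c"
        using c words finite_word by (subst card_Diff_subset) auto
      moreover have "8 * N - card c = 4 * ((8 * N - card c) div 4)"
        using doubly_even[OF c] by (auto simp: dvd_diff_nat)
      ultimately show ?thesis using none complement_in_dual[OF c] by metis
    qed
    moreover have "card u div 4 \<noteq> k" if "u \<in> binary_dual (8 * N) D" "4 dvd card u" for u
      using none that by auto
    ultimately have "coeff orbit_poly k = 0"
      unfolding coeff_orbit_poly by (auto intro!: sum.neutral)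
    then show False using assms by simp
  qed
  then show ?thesis using that by blast
qed

end

section \<open>Self-dual codes modulo 4\<close>

lemma z4_cases:
  obtains "(x :: z4) = 0" | "x = 1" | "x = 2" | "x = 3"
proof (cases x rule: bit0.cases)
  case (1 z)
  then have "z = 0 \<or> z = 1 \<or> z = 2 \<or> z = 3" by auto
  then show ?thesis using 1 that by auto
qed

lemma of_nat_z4_eq_0:
  assumes "(of_nat m :: z4) = 0"
  shows "4 dvd m"
proof -
  define q r where "q = m div 4" and "r = m mod 4"
  have m: "m = 4 * q + r" "r < 4" by (simp_all add: q_def r_def)
  have "(4 :: z4) = 0" by simp
  then have "(of_nat r :: z4) = 0"
    using assms unfolding m(1) by (metis add_0 mult_zero_left of_nat_add of_nat_mult of_nat_numeral)
  moreover have "r = 0 \<or> r = 1 \<or> r = 2 \<or> r = 3" using m(2) by linarith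
  ultimately have "r = 0" by auto
  then show ?thesis by (simp add: m(1))
qed

text \<open>The support of the reduction modulo 2; the image of a code is its residue code.\<close>

definition odd_coords :: "z4 vec \<Rightarrow> nat set" where
  "odd_coords v = {i. i < dim_vec v \<and> (v $ i = 1 \<or> v $ i = 3)}"

definition double_indicator :: "nat \<Rightarrow> nat set \<Rightarrow> z4 vec" where
  "double_indicator n u = vec n (\<lambda>i. if i \<in> u then 2 else 0)"

lemma finite_odd_coords [simp]: "finite (odd_coords v)"
  by (simp add: odd_coords_def)

lemma odd_coords_add:
  assumes "v \<in> carrier_vec n" "w \<in> carrier_vec n"
  shows "odd_coords (v + w) = sym_diff (odd_coords v) (odd_coords w)"
proof -
  have odd: "(a + b = 1 \<or> a + b = 3) \<longleftrightarrow> (a = 1 \<or> a = 3) \<noteq> (b = 1 \<or> b = 3)" for a b :: z4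
    by (cases a rule: z4_cases; cases b rule: z4_cases) simp_all
  have "i \<in> odd_coords (v + w) \<longleftrightarrow> i \<in> sym_diff (odd_coords v) (odd_coords w)" for i
  proof (cases "i < n")
    case True
    then have "(v + w) $ i = v $ i + w $ i" using assms by simp
    then show ?thesis using True assms odd[of "v $ i" "w $ i"] by (simp add: odd_coords_def) blast
  next
    case False
    then show ?thesis using assms by (auto simp: odd_coords_def)
  qed
  then show ?thesis by blast
qed

text \<open>Odd squares are 1 and even squares 0 modulo 4, so self-orthogonality yields doubly-even
  residues.\<close>

lemma scalar_prod_self_z4: "v \<bullet> v = of_nat (card (odd_coords v))"
proof -
  have "a * a = (if a = 1 \<or> a = 3 then 1 else 0)" for a :: z4
    by (cases a rule: z4_cases) simp_all
  then have "v \<bullet> v = (\<Sum>i=0..<dim_vec v. if v $ i = 1 \<or> v $ i = 3 then 1 else 0)"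
    unfolding scalar_prod_def by (intro sum.cong refl) blast
  also have "\<dots> = of_nat (card ({0..<dim_vec v} \<inter> {i. v $ i = 1 \<or> v $ i = 3}))"
    by (simp add: sum.If_cases)
  also have "{0..<dim_vec v} \<inter> {i. v $ i = 1 \<or> v $ i = 3} = odd_coords v"
    by (auto simp: odd_coords_def)
  finally show ?thesis .
qed

text \<open>Doubling in the integers modulo 4 sees only parity, which turns binary orthogonality
  into orthogonality here.\<close>

lemma scalar_prod_double_indicator:
  assumes "c \<in> carrier_vec n" "u \<subseteq> {..<n}"
  shows "double_indicator n u \<bullet> c = 2 * of_nat (card (u \<inter> odd_coords c))"
proof -
  have e: "2 * a = (if a = 1 \<or> a = 3 then 2 else 0)" for a :: z4
    by (cases a rule: z4_cases) simp_all
  have "double_indicator n u \<bullet> c = (\<Sum>i=0..<n. if i \<in> u \<and> (c $ i = 1 \<or> c $ i = 3) then 2 else 0)"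
    unfolding scalar_prod_def using assms(1)
    by (intro sum.cong) (auto simp: double_indicator_def e)
  also have "\<dots> = of_nat (card ({0..<n} \<inter> {i. i \<in> u \<and> (c $ i = 1 \<or> c $ i = 3)})) * 2"
    by (simp add: sum.If_cases)
  also have "{0..<n} \<inter> {i. i \<in> u \<and> (c $ i = 1 \<or> c $ i = 3)} = u \<inter> odd_coords c"
    using assms by (auto simp: odd_coords_def)
  finally show ?thesis by (simp add: mult.commute)
qed

lemma hamming_weight_double_indicator:
  assumes "u \<subseteq> {..<n}"
  shows "hamming_weight (double_indicator n u) = card u"
proof -
  have "{i. i < dim_vec (double_indicator n u) \<and> double_indicator n u $ i \<noteq> 0} = u"
    using assms by (auto simp: double_indicator_def split: if_splits)
  then show ?thesis by (simp add: hamming_weight_def)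
qed

lemma lee_weight_double_indicator:
  assumes "u \<subseteq> {..<n}"
  shows "lee_weight (double_indicator n u) = 2 * card u"
proof -
  have "lee_weight (double_indicator n u) = (\<Sum>i<n. if i \<in> u then 2 else 0)"
    unfolding lee_weight_def by (intro sum.cong) (auto simp: double_indicator_def lee_weight_z4_def)
  also have "\<dots> = 2 * card ({..<n} \<inter> u)" by (simp add: sum.If_cases)
  also have "{..<n} \<inter> u = u" using assms by auto
  finally show ?thesis .
qed

lemma double_indicator_nonzero:
  assumes "u \<subseteq> {..<n}" "u \<noteq> {}"
  shows "double_indicator n u \<noteq> 0\<^sub>v (dim_vec (double_indicator n u))"
proof -
  obtain i where i: "i \<in> u" "i < n" using assms by auto
  then have "double_indicator n u $ i \<noteq> 0" by (simp add: double_indicator_def)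
  then show ?thesis using i by (metis double_indicator_def dim_vec index_zero_vec(1))
qed

lemma self_dual_code_iff:
  assumes "self_dual_code n C"
  shows "v \<in> C \<longleftrightarrow> v \<in> carrier_vec n \<and> (\<forall>c\<in>C. v \<bullet> c = 0)"
  using assms unfolding self_dual_code_def dual_code_def by blast

lemma self_dual_code_add:
  assumes "self_dual_code n C" "v \<in> C" "w \<in> C"
  shows "v + w \<in> C"
proof -
  have v: "v \<in> carrier_vec n" "\<forall>c\<in>C. v \<bullet> c = 0" and w: "w \<in> carrier_vec n" "\<forall>c\<in>C. w \<bullet> c = 0"
    using assms(2,3) unfolding self_dual_code_iff[OF assms(1)] by auto
  have "(v + w) \<bullet> c = 0" if "c \<in> C" for c
  proof -
    have "c \<in> carrier_vec n" using that self_dual_code_iff[OF assms(1)] by blast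
    then show ?thesis using v w that by (simp add: add_scalar_prod_distrib[of _ n])
  qed
  moreover have "v + w \<in> carrier_vec n" using v w by simp
  ultimately show ?thesis using self_dual_code_iff[OF assms(1)] by blast
qed

lemma self_dual_code_zero:
  assumes "self_dual_code n C"
  shows "0\<^sub>v n \<in> C"
proof -
  have "0\<^sub>v n \<bullet> c = 0" if "c \<in> C" for c
  proof -
    have "c \<in> carrier_vec n" using that self_dual_code_iff[OF assms] by blast
    then show ?thesis by simp
  qed
  moreover have "0\<^sub>v n \<in> carrier_vec n" by simp
  ultimately show ?thesis using self_dual_code_iff[OF assms] by blast
qed

lemma odd_coords_doubly_even:
  assumes C: "self_dual_code n C" and n: "n \<le> 8 * N"
  shows "doubly_even_code N (odd_coords ` C)"
proof
  have carrier: "v \<in> carrier_vec n" if "v \<in> C" for v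
    using that self_dual_code_iff[OF C] by blast
  show "odd_coords ` C \<subseteq> Pow {..<8 * N}"
    using carrier n by (fastforce simp: odd_coords_def)
  have "odd_coords (0\<^sub>v n) = {}" by (auto simp: odd_coords_def)
  then show "{} \<in> odd_coords ` C" using self_dual_code_zero[OF C] by (metis imageI)
  show "sym_diff a b \<in> odd_coords ` C" if ab: "a \<in> odd_coords ` C" "b \<in> odd_coords ` C" for a b
  proof -
    obtain v w where vw: "v \<in> C" "w \<in> C" "a = odd_coords v" "b = odd_coords w" using ab by blast
    then have "sym_diff a b = odd_coords (v + w)" using odd_coords_add[OF carrier carrier] by simp
    then show ?thesis using self_dual_code_add[OF C vw(1,2)] by blast
  qed
  show "4 dvd card c" if c: "c \<in> odd_coords ` C" for c
  proof -
    obtain v where v: "v \<in> C" "c = odd_coords v" using c by blast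
    then have "v \<bullet> v = 0" using self_dual_code_iff[OF C] by blast
    then show ?thesis using v of_nat_z4_eq_0 unfolding scalar_prod_self_z4 by blast
  qed
qed

lemma double_indicator_in_self_dual_code:
  assumes C: "self_dual_code n C" and u: "u \<subseteq> {..<n}" "\<And>v. v \<in> C \<Longrightarrow> even (card (u \<inter> odd_coords v))"
  shows "double_indicator n u \<in> C"
proof -
  have "double_indicator n u \<bullet> c = 0" if c: "c \<in> C" for c
  proof -
    have "c \<in> carrier_vec n" using c self_dual_code_iff[OF C] by blast
    then have "double_indicator n u \<bullet> c = 2 * of_nat (card (u \<inter> odd_coords c))"
      using u(1) by (rule scalar_prod_double_indicator)
    moreover obtain q where "card (u \<inter> odd_coords c) = 2 * q" using u(2)[OF c] by blast
    moreover have "(4 :: z4) * of_nat q = 0"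
    proof -
      have "(4 :: z4) = 0" by simp
      then show ?thesis by (metis mult_zero_left)
    qed
    ultimately show ?thesis by simp
  qed
  moreover have "double_indicator n u \<in> carrier_vec n" by (simp add: double_indicator_def)
  ultimately show ?thesis using self_dual_code_iff[OF C] by blast
qed

lemma self_dual_code_light_word:
  fixes \<epsilon> s :: real
  assumes s: "s > 0" "s ^ 4 = 1 / 5" and \<epsilon>: "\<epsilon> > 0"
  shows "\<exists>n0. \<forall>n\<ge>n0. \<forall>C. self_dual_code n C \<longrightarrow>
           (\<exists>u\<subseteq>{..<n}. u \<noteq> {} \<and> double_indicator n u \<in> C \<and> real (card u) \<le> ((1 - s) / 2 + \<epsilon>) * real n)"
proof -
  define a where "a = (1 - s) / 2 + \<epsilon> / 2"
  have a: "a > 0" using fourth_root_fifth_bounds[OF s] \<epsilon> by (simp add: a_def add_pos_pos)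
  have "\<exists>N0. \<forall>N\<ge>N0. \<forall>f. oct_invariant N f \<longrightarrow> (\<forall>k. coeff f k \<ge> 0) \<longrightarrow> coeff f 0 > 0 \<longrightarrow>
      (\<exists>k\<ge>2. coeff f k > 0 \<and> real k < a * (2 * real N))"
    unfolding a_def using \<epsilon> by (intro oct_invariant_min_weight[OF s]) simp
  then obtain N0 where N0: "\<And>N f. N0 \<le> N \<Longrightarrow> oct_invariant N f \<Longrightarrow> (\<forall>k. coeff f k \<ge> 0) \<Longrightarrow> coeff f 0 > 0 \<Longrightarrow>
      \<exists>k\<ge>2. coeff f k > 0 \<and> real k < a * (2 * real N)" by blast
  \<comment> \<open>Half of \<open>\<epsilon>\<close> went into \<open>a\<close>; the other half
    pays for the at most 7 padded coordinates.\<close>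
  obtain n1 :: nat where n1: "real n1 > 7 * a / (\<epsilon> / 2)" using reals_Archimedean2 by blast
  show ?thesis
  proof (rule exI[of _ "8 * N0 + n1"], intro allI impI)
    fix n C assume n: "8 * N0 + n1 \<le> n" and C: "self_dual_code n C"
    define N where "N = (n + 7) div 8"
    have N: "n \<le> 8 * N" "8 * N \<le> n + 7" "N0 \<le> N" using n by (auto simp: N_def)
    interpret doubly_even_code N "odd_coords ` C" by (rule odd_coords_doubly_even[OF C N(1)])
    obtain k where k: "2 \<le> k" "coeff orbit_poly k > 0" "real k < a * (2 * real N)"
      using N0[OF N(3) oct_invariant_orbit_poly] coeff_orbit_poly_nonneg coeff_orbit_poly_0 by blast
    obtain u' where u': "u' \<in> binary_dual (8 * N) (odd_coords ` C)" "card u' = 4 * k"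
      using coeff_orbit_poly_pos[OF k(2)] by blast
    then have fin: "finite u'" "u' \<subseteq> {..<8 * N}" by (auto simp: binary_dual_def intro: finite_subset)
    \<comment> \<open>Cutting back to the true length removes at most 7 elements, while
      \<open>k \<ge> 2\<close> gives at least 8; so \<open>u\<close> stays nonempty.\<close>
    define u where "u = u' \<inter> {..<n}"
    have "card u' = card u + card (u' - {..<n})" unfolding u_def using fin by (metis card_Int_Diff)
    moreover have "card (u' - {..<n}) \<le> card {n..<8 * N}" using fin by (intro card_mono) auto
    ultimately have "card u > 0" using u'(2) k(1) N(2) by simp
    then have "u \<noteq> {}" by auto
    moreover have "u \<subseteq> {..<n}" by (simp add: u_def)
    moreover have "double_indicator n u \<in> C"
    proof (rule double_indicator_in_self_dual_code[OF C \<open>u \<subseteq> {..<n}\<close>])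
      fix v assume v: "v \<in> C"
      have "v \<in> carrier_vec n" using v self_dual_code_iff[OF C] by blast
      then have "odd_coords v \<subseteq> {..<n}" by (auto simp: odd_coords_def)
      then have "u \<inter> odd_coords v = u' \<inter> odd_coords v" by (auto simp: u_def)
      then show "even (card (u \<inter> odd_coords v))" using u'(1) v by (simp add: binary_dual_def)
    qed
    moreover have "real (card u) \<le> ((1 - s) / 2 + \<epsilon>) * real n"
    proof -
      have "card u \<le> 4 * k" unfolding u'(2)[symmetric] u_def using fin by (intro card_mono) auto
      then have "real (card u) \<le> 4 * real k" by simp
      also have "\<dots> \<le> a * real (8 * N)" using k(3) by simp
      also have "\<dots> \<le> a * real (n + 7)" using a N(2) by (intro mult_left_mono of_nat_mono) auto
      also have "\<dots> = a * real n + 7 * a" by (simp add: algebra_simps)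
      also have "7 * a \<le> \<epsilon> / 2 * real n"
      proof -
        have "7 * a \<le> \<epsilon> / 2 * real n1" using n1 \<epsilon> by (simp add: field_simps)
        also have "\<dots> \<le> \<epsilon> / 2 * real n" using n \<epsilon> by (intro mult_left_mono) auto
        finally show ?thesis .
      qed
      finally show ?thesis by (simp add: a_def algebra_simps)
    qed
    ultimately show "\<exists>u\<subseteq>{..<n}. u \<noteq> {} \<and> double_indicator n u \<in> C \<and> real (card u) \<le> ((1 - s) / 2 + \<epsilon>) * real n"
      by blast
  qed
qed

section \<open>Passage to the upper limits\<close>

lemma limsup_le_of_eventually_le_add:
  fixes x :: "nat \<Rightarrow> real"
  assumes "\<And>e. e > 0 \<Longrightarrow> eventually (\<lambda>i. x i \<le> L + e) sequentially"
  shows "limsup (\<lambda>i. ereal (x i)) \<le> ereal L"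
proof (rule ereal_le_epsilon2)
  fix e :: real assume "0 < e"
  then have "limsup (\<lambda>i. ereal (x i)) \<le> ereal (L + e)"
    using assms[of e] by (intro Limsup_bounded) simp
  then show "limsup (\<lambda>i. ereal (x i)) \<le> ereal L + ereal e" by simp
qed

theorem theorem4:
  fixes C :: "nat \<Rightarrow> z4 vec set" and n :: "nat \<Rightarrow> nat"
  assumes "\<And>i. self_dual_code (n i) (C i)"
    and "filterlim n at_top sequentially"
  shows "limsup (\<lambda>i. ereal (real (min_hamming_weight (C i)) / real (n i)))
           \<le> ereal ((1 - 5 powr (-1/4)) / 2)
       \<and> limsup (\<lambda>i. ereal (real (min_lee_weight (C i)) / real (n i)))
           \<le> ereal (1 - 5 powr (-1/4))"
proof -
  define s :: real where "s = 5 powr (-1/4)"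
  have "s > 0" by (simp add: s_def)
  then have "s ^ 4 = s powr real 4" by (simp only: powr_realpow)
  also have "\<dots> = 5 powr (-1)" by (simp add: s_def powr_powr)
  finally have s: "s > 0" "s ^ 4 = 1 / 5" using \<open>s > 0\<close> by (simp_all add: powr_minus_divide)
  have ev: "eventually (\<lambda>i. real (min_hamming_weight (C i)) / real (n i) \<le> (1 - s) / 2 + e \<and>
      real (min_lee_weight (C i)) / real (n i) \<le> 1 - s + 2 * e) sequentially" if e: "e > 0" for e
  proof -
    obtain n0 where n0: "\<And>m D. n0 \<le> m \<Longrightarrow> self_dual_code m D \<Longrightarrow>
      \<exists>u\<subseteq>{..<m}. u \<noteq> {} \<and> double_indicator m u \<in> D \<and> real (card u) \<le> ((1 - s) / 2 + e) * real m"
      using self_dual_code_light_word[OF s e] by blast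
    \<comment> \<open>The bound 1 makes the division by \<open>n i\<close> legitimate.\<close>
    have "eventually (\<lambda>i. n i \<ge> max n0 1) sequentially"
      using assms(2) unfolding filterlim_at_top by blast
    then show ?thesis
    proof eventually_elim
      case (elim i)
      obtain u where u: "u \<subseteq> {..<n i}" "u \<noteq> {}" "double_indicator (n i) u \<in> C i"
        "real (card u) \<le> ((1 - s) / 2 + e) * real (n i)"
        using n0[of "n i" "C i"] elim assms(1) by auto
      let ?w = "double_indicator (n i) u"
      have w: "?w \<in> {c \<in> C i. c \<noteq> 0\<^sub>v (dim_vec c)}" using u double_indicator_nonzero by blast
      have "min_hamming_weight (C i) \<le> card u"
        unfolding min_hamming_weight_def hamming_weight_double_indicator[OF u(1), symmetric]
        using w by (intro cInf_lower imageI) auto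
      moreover have "min_lee_weight (C i) \<le> 2 * card u"
        unfolding min_lee_weight_def lee_weight_double_indicator[OF u(1), symmetric]
        using w by (intro cInf_lower imageI) auto
      ultimately have "real (min_hamming_weight (C i)) \<le> ((1 - s) / 2 + e) * real (n i)"
        "real (min_lee_weight (C i)) \<le> 2 * (((1 - s) / 2 + e) * real (n i))"
        using u(4) by linarith+
      moreover have "2 * (((1 - s) / 2 + e) * real (n i)) = (1 - s + 2 * e) * real (n i)"
        by (simp add: field_simps)
      ultimately show ?case using elim by (simp add: pos_divide_le_eq)
    qed
  qed
  have "limsup (\<lambda>i. ereal (real (min_hamming_weight (C i)) / real (n i))) \<le> ereal ((1 - s) / 2)"
    by (rule limsup_le_of_eventually_le_add, rule eventually_mono[OF ev]) auto
  moreover have "limsup (\<lambda>i. ereal (real (min_lee_weight (C i)) / real (n i))) \<le> ereal (1 - s)"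
  proof (rule limsup_le_of_eventually_le_add)
    fix e :: real assume "e > 0"
    then show "eventually (\<lambda>i. real (min_lee_weight (C i)) / real (n i) \<le> 1 - s + e) sequentially"
      using eventually_mono[OF ev[of "e / 2"]] by simp
  qed
  ultimately show ?thesis unfolding s_def by simp
qed

end
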